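(* Let $\Delta$ be an infinite additive subgroup of $\mathbb{C}$, let $b\in\mathbb{C}$ with $2b\notin\Delta$, and let $\varphi:\Delta\to\mathbb{C}^+$ be a group homomorphism. Then $\mathrm{CDer}(CL(b,\varphi))=\mathrm{CInn}(CL(b,\varphi))$, i.e. every conformal derivation of $CL(b,\varphi)$ is inner.
   Context: $\mathbb{C}^+$ is the additive group of $\mathbb{C}$. A Lie conformal algebra $R$ is a $\mathbb{C}[\partial]$-module with a $\mathbb{C}$-bilinear map ($\lambda$-bracket) $R\times R\to R[\lambda]$, $(a,b)\mapsto[a_\lambda b]$, satisfying $[\partial a_\lambda b]=-\lambda[a_\lambda b]$, $[a_\lambda\partial b]=(\lambda+\partial)[a_\lambda b]$, $[a_\lambda b]=-[b_{-\lambda-\partial}a]$ and $[a_\lambda[b_\mu c]]=[[a_\lambda b]_{\lambda+\mu}c]+[b_\mu[a_\lambda c]]$ for all $a,b,c\in R$. $CL(b,\varphi)=\bigoplus_{\alpha\in\Delta}\mathbb{C}[\partial]x_\alpha$ is the Lie conformal algebra which is free as a $\mathbb{C}[\partial]$-module on $\{x_\alpha\}_{\alpha\in\Delta}$, with $$[{x_\alpha}_\lambda x_\beta]=\big((\alpha+b)\partial+(\alpha+\beta+2b)\lambda\big)x_{\alpha+\beta}+\tfrac1b\big(\varphi(\alpha)\beta-\varphi(\beta)\alpha+b(\varphi(\alpha)-\varphi(\beta))\big)x_{\alpha+\beta}.$$ A conformal linear map between $\mathbb{C}[\partial]$-modules $U,W$ is a $\mathbb{C}$-linear map $\phi_\lambda:U\to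 W[\lambda]$ with $\phi_\lambda(\partial u)=(\partial+\lambda)\phi_\lambda u$ for all $u\in U$. A conformal derivation of $R$ is a conformal linear map $d_\lambda:R\to R[\lambda]$ with $d_\lambda[a_\mu b]=[(d_\lambda a)_{\lambda+\mu}b]+[a_\mu(d_\lambda b)]$ for all $a,b\in R$; $\mathrm{CDer}(R)$ is the space of all of them. For $a\in R$, $\mathrm{ad}(a)_\lambda b=[a_\lambda b]$; conformal derivations of the form $\mathrm{ad}(a)_\lambda$ with $a\in R$ are called inner and form the space $\mathrm{CInn}(R)$. *)

theory Defs
  imports
    Complex_Main
    "HOL-Library.FuncSet"
    "HOL-Library.Poly_Mapping"
    "HOL-Computational_Algebra.Polynomial"
begin

text \<open>
  A \<open>\<complex>[\<partial>]\<close>-module is a module over the ring \<^typ>\<open>complex poly\<close>, so \<open>\<partial>\<close> is the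
  polynomial \<open>[:0, 1:]\<close>. Elements of \<open>R[\<lambda>]\<close> are polynomials with coefficients in \<open>R\<close>,
  and elements of \<open>R[\<lambda>, \<mu>]\<close> have type \<open>'a poly poly\<close>, where the inner variable is \<open>\<lambda>\<close> and
  the outer one is \<open>\<mu>\<close>.
\<close>

record (overloaded) ('a :: zero) conformal_algebra =
  carr :: "'a set"
  act :: "complex poly \<Rightarrow> 'a \<Rightarrow> 'a"
  lbr :: "'a \<Rightarrow> 'a \<Rightarrow> 'a poly"

definition dact :: "('a::zero, 'm) conformal_algebra_scheme \<Rightarrow> 'a \<Rightarrow> 'a" where
  "dact R = act R [:0, 1:]"

definition cact :: "('a::zero, 'm) conformal_algebra_scheme \<Rightarrow> complex \<Rightarrow> 'a \<Rightarrow> 'a" where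
  "cact R c = act R [:c:]"

definition mult_lam :: "'a::zero poly poly \<Rightarrow> 'a poly poly" where
  "mult_lam = map_poly (pCons 0)"

definition mult_mu :: "'a::zero poly poly \<Rightarrow> 'a poly poly" where
  "mult_mu = pCons 0"

definition mult_lam_mu :: "'a::comm_monoid_add poly poly \<Rightarrow> 'a poly poly" where
  "mult_lam_mu P = mult_lam P + mult_mu P"

definition const2 :: "'a::zero \<Rightarrow> 'a poly poly" where
  "const2 r = [:[:r:]:]"

text \<open>
  For \<open>p = \<Sum>\<^sub>i \<lambda>\<^sup>i p\<^sub>i\<close> the element \<open>\<Sum>\<^sub>i T\<^sup>i (F p\<^sub>i)\<close>: the variable is replaced by the operator
  \<open>T\<close> and the coefficients are mapped by \<open>F\<close>. For example, \<open>psubst mult_lam_mu const2 (lbr R a b)\<close>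
  is \<open>[a\<^bsub>\<lambda>+\<mu>\<^esub> b]\<close>.
\<close>

definition psubst :: "('b::comm_monoid_add \<Rightarrow> 'b) \<Rightarrow> ('a::zero \<Rightarrow> 'b) \<Rightarrow> 'a poly \<Rightarrow> 'b" where
  "psubst T F p = (\<Sum>i\<le>degree p. (T ^^ i) (F (coeff p i)))"

text \<open>A conformal linear map from the underlying \<open>\<complex>[\<partial>]\<close>-module of \<open>R\<close> to itself.\<close>

definition conformal_linear ::
    "('a::ab_group_add, 'm) conformal_algebra_scheme \<Rightarrow> ('a \<Rightarrow> 'a poly) \<Rightarrow> bool" where
  "conformal_linear R d \<longleftrightarrow>
    (\<forall>a\<in>carr R. \<forall>i. coeff (d a) i \<in> carr R) \<and>
    (\<forall>a\<in>carr R. \<forall>b\<in>carr R. d (a + b) = d a + d b) \<and>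
    (\<forall>c. \<forall>a\<in>carr R. d (cact R c a) = map_poly (cact R c) (d a)) \<and>
    (\<forall>a\<in>carr R. d (dact R a) = map_poly (dact R) (d a) + pCons 0 (d a))"

text \<open>
  The identity \<open>d\<^sub>\<lambda> [a\<^sub>\<mu> b] = [(d\<^sub>\<lambda> a)\<^bsub>\<lambda>+\<mu>\<^esub> b] + [a\<^sub>\<mu> (d\<^sub>\<lambda> b)]\<close> in \<open>R[\<lambda>, \<mu>]\<close>. For \<open>d = lbr R a'\<close>
  it is the Jacobi identity.
\<close>

definition conformal_leibniz ::
    "('a::ab_group_add, 'm) conformal_algebra_scheme \<Rightarrow> ('a \<Rightarrow> 'a poly) \<Rightarrow> 'a \<Rightarrow> 'a \<Rightarrow> bool" where
  "conformal_leibniz R d a b \<longleftrightarrow>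
    psubst mult_mu (\<lambda>x. psubst mult_lam const2 (d x)) (lbr R a b) =
    psubst mult_lam (\<lambda>x. psubst mult_lam_mu const2 (lbr R x b)) (d a) +
    psubst mult_lam (\<lambda>x. psubst mult_mu const2 (lbr R a x)) (d b)"

definition lie_conformal_algebra :: "('a::ab_group_add, 'm) conformal_algebra_scheme \<Rightarrow> bool" where
  "lie_conformal_algebra R \<longleftrightarrow>
    module (act R) \<and> module.subspace (act R) (carr R) \<and>
    (\<forall>a\<in>carr R. \<forall>b\<in>carr R. \<forall>i. coeff (lbr R a b) i \<in> carr R) \<and>
    (\<forall>a\<in>carr R. \<forall>b\<in>carr R. \<forall>c\<in>carr R. lbr R (a + b) c = lbr R a c + lbr R b c) \<and>
    (\<forall>a\<in>carr R. \<forall>b\<in>carr R. \<forall>c\<in>carr R. lbr R a (b + c) = lbr R a b + lbr R a c) \<and>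
    (\<forall>k. \<forall>a\<in>carr R. \<forall>b\<in>carr R. lbr R (cact R k a) b = map_poly (cact R k) (lbr R a b)) \<and>
    (\<forall>k. \<forall>a\<in>carr R. \<forall>b\<in>carr R. lbr R a (cact R k b) = map_poly (cact R k) (lbr R a b)) \<and>
    (\<forall>a\<in>carr R. \<forall>b\<in>carr R. lbr R (dact R a) b = - pCons 0 (lbr R a b)) \<and>
    (\<forall>a\<in>carr R. \<forall>b\<in>carr R.
      lbr R a (dact R b) = pCons 0 (lbr R a b) + map_poly (dact R) (lbr R a b)) \<and>
    (\<forall>a\<in>carr R. \<forall>b\<in>carr R.
      lbr R a b = - psubst (\<lambda>P. - pCons 0 P - map_poly (dact R) P) (\<lambda>r. [:r:]) (lbr R b a)) \<and>
    (\<forall>a\<in>carr R. \<forall>b\<in>carr R. \<forall>c\<in>carr R. conformal_leibniz R (lbr R a) b c)"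

text \<open>
  Maps on \<open>R\<close> are HOL functions that are \<^const>\<open>undefined\<close> outside the carrier, so that equality
  of functions is equality on \<open>R\<close>.
\<close>

definition CDer :: "('a::ab_group_add, 'm) conformal_algebra_scheme \<Rightarrow> ('a \<Rightarrow> 'a poly) set" where
  "CDer R = {d \<in> extensional (carr R). conformal_linear R d \<and>
    (\<forall>a\<in>carr R. \<forall>b\<in>carr R. conformal_leibniz R d a b)}"

definition cad :: "('a::ab_group_add, 'm) conformal_algebra_scheme \<Rightarrow> 'a \<Rightarrow> 'a \<Rightarrow> 'a poly" where
  "cad R a = restrict (lbr R a) (carr R)"

definition CInn :: "('a::ab_group_add, 'm) conformal_algebra_scheme \<Rightarrow> ('a \<Rightarrow> 'a poly) set" where
  "CInn R = cad R ` carr R"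

text \<open>
  The algebra \<open>CL(b, \<phi>)\<close>. Elements are finitely supported families of polynomials in \<open>\<partial>\<close>, and
  \<open>p(\<partial>) x\<^sub>\<alpha>\<close> is \<open>Poly_Mapping.single \<alpha> p\<close>. In \<open>\<complex>[\<partial>][\<lambda>]\<close>, of type \<^typ>\<open>complex poly poly\<close>, the
  variable \<open>\<partial>\<close> is \<open>[:[:0, 1:]:]\<close> and \<open>\<lambda>\<close> is \<open>[:0, 1:]\<close>.
\<close>

definition psub2 :: "complex poly \<Rightarrow> complex poly poly \<Rightarrow> complex poly poly" where
  "psub2 p t = poly (map_poly (\<lambda>c. [:[:c:]:]) p) t"

definition CL_coeff ::
    "complex \<Rightarrow> (complex \<Rightarrow> complex) \<Rightarrow> complex \<Rightarrow> complex \<Rightarrow> complex poly poly" where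
  "CL_coeff b \<phi> \<alpha> \<beta> =
    [:[:\<alpha> + b:]:] * [:[:0, 1:]:] + [:[:\<alpha> + \<beta> + 2 * b:]:] * [:0, 1:] +
    [:[:1 / b * (\<phi> \<alpha> * \<beta> - \<phi> \<beta> * \<alpha> + b * (\<phi> \<alpha> - \<phi> \<beta>)):]:]"

text \<open>
  By sesquilinearity,
  \<open>[p(\<partial>)x\<^sub>\<alpha> \<^sub>\<lambda> q(\<partial>)x\<^sub>\<beta>] = p(-\<lambda>) q(\<partial>+\<lambda>) [x\<^sub>\<alpha> \<^sub>\<lambda> x\<^sub>\<beta>]\<close>.
\<close>

definition CL_bracket ::
    "complex \<Rightarrow> (complex \<Rightarrow> complex) \<Rightarrow> (complex \<Rightarrow>\<^sub>0 complex poly) \<Rightarrow> (complex \<Rightarrow>\<^sub>0 complex poly) \<Rightarrow>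
     (complex \<Rightarrow>\<^sub>0 complex poly) poly" where
  "CL_bracket b \<phi> u v = (\<Sum>\<alpha>\<in>Poly_Mapping.keys u. \<Sum>\<beta>\<in>Poly_Mapping.keys v.
    map_poly (Poly_Mapping.single (\<alpha> + \<beta>))
      (psub2 (Poly_Mapping.lookup u \<alpha>) (- [:0, 1:]) *
       psub2 (Poly_Mapping.lookup v \<beta>) ([:[:0, 1:]:] + [:0, 1:]) *
       CL_coeff b \<phi> \<alpha> \<beta>))"

definition CL ::
    "complex set \<Rightarrow> complex \<Rightarrow> (complex \<Rightarrow> complex) \<Rightarrow> (complex \<Rightarrow>\<^sub>0 complex poly) conformal_algebra"
  where
  "CL \<Delta> b \<phi> =
    \<lparr> carr = {u. Poly_Mapping.keys u \<subseteq> \<Delta>},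
      act = (\<lambda>p. Poly_Mapping.map ((*) p)),
      lbr = CL_bracket b \<phi> \<rparr>"

text \<open>
  The rest of the theory shows that \<open>CL(b, \<phi>)\<close> is a Lie conformal algebra with the intended bracket
  on the generators \<open>x\<^sub>\<alpha>\<close>; see \<open>CL_bracket_generators\<close> and \<open>lie_conformal_algebra_CL\<close>.
\<close>

lemma CL_simps [simp]:
  "carr (CL \<Delta> b \<phi>) = {u. Poly_Mapping.keys u \<subseteq> \<Delta>}"
  "act (CL \<Delta> b \<phi>) = (\<lambda>p. Poly_Mapping.map ((*) p))"
  "lbr (CL \<Delta> b \<phi>) = CL_bracket b \<phi>"
  by (simp_all add: CL_def)

lemma psub2_0 [simp]: "psub2 0 t = 0"
  by (simp add: psub2_def)

lemma psub2_const: "psub2 [:c:] t = [:[:c:]:]"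
  by (simp add: psub2_def map_poly_pCons)

lemma psub2_1 [simp]: "psub2 1 t = 1"
  using psub2_const[of 1 t] by (simp flip: one_pCons)

lemma CL_bracket_single:
  "CL_bracket b \<phi> (Poly_Mapping.single \<alpha> p) (Poly_Mapping.single \<beta> q) =
    map_poly (Poly_Mapping.single (\<alpha> + \<beta>))
      (psub2 p (- [:0, 1:]) * psub2 q ([:[:0, 1:]:] + [:0, 1:]) * CL_coeff b \<phi> \<alpha> \<beta>)"
  by (simp add: CL_bracket_def)

lemma CL_bracket_generators:
  "CL_bracket b \<phi> (Poly_Mapping.single \<alpha> 1) (Poly_Mapping.single \<beta> 1) =
    map_poly (Poly_Mapping.single (\<alpha> + \<beta>)) (CL_coeff b \<phi> \<alpha> \<beta>)"
  by (simp add: CL_bracket_single)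

definition ishom :: "('a::comm_ring_1 \<Rightarrow> 'b::comm_ring_1) \<Rightarrow> bool" where
  "ishom h \<longleftrightarrow> h 0 = 0 \<and> h 1 = 1 \<and> (\<forall>x y. h (x + y) = h x + h y) \<and> (\<forall>x y. h (x * y) = h x * h y)"

lemma ishomD:
  assumes "ishom h"
  shows "h 0 = 0" "h 1 = 1" "h (x + y) = h x + h y" "h (x * y) = h x * h y"
    "h (- x) = - h x" "h (x - y) = h x - h y"
proof -
  show *: "h 0 = 0" "h 1 = 1" "h (x + y) = h x + h y" "h (x * y) = h x * h y" for x y
    using assms by (auto simp: ishom_def)
  show m: "h (- x) = - h x" for x
    using *(1) *(3)[of x "- x"] by (simp add: eq_neg_iff_add_eq_0 add.commute)
  show "h (x - y) = h x - h y"
    using *(3)[of x "- y"] m[of y] by simp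
qed

definition ev1 :: "('a::comm_ring_1 \<Rightarrow> 'b::comm_ring_1) \<Rightarrow> 'b \<Rightarrow> 'a poly \<Rightarrow> 'b" where
  "ev1 h t p = poly (map_poly h p) t"

lemma psub2_ev1: "psub2 p t = ev1 (\<lambda>c. [:[:c:]:]) t p"
  by (simp add: psub2_def ev1_def)

lemma ev1_pCons: "ishom h \<Longrightarrow> ev1 h t (pCons c p) = h c + t * ev1 h t p"
  by (simp add: ev1_def map_poly_pCons ishomD(1))

lemma ev1_0: "ev1 h t 0 = 0"
  by (simp add: ev1_def)

lemma ev1_add: "ishom h \<Longrightarrow> ev1 h t (p + q) = ev1 h t p + ev1 h t q"
  by (induction p q rule: poly_induct2) (simp_all add: ev1_pCons ev1_0 ishomD algebra_simps)

lemma ev1_smult: "ishom h \<Longrightarrow> ev1 h t (smult c p) = h c * ev1 h t p"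
  by (induction p) (simp_all add: ev1_pCons ev1_0 ishomD algebra_simps)

lemma ev1_mult: "ishom h \<Longrightarrow> ev1 h t (p * q) = ev1 h t p * ev1 h t q"
  by (induction p) (simp_all add: ev1_pCons ev1_0 ev1_add ev1_smult ishomD(1) algebra_simps)

lemma ev1_hom [intro]: "ishom h \<Longrightarrow> ishom (ev1 h t)"
  by (simp add: ishom_def[of "ev1 h t"] ev1_0 ev1_add ev1_mult)
    (simp add: one_pCons ev1_pCons ev1_0 ishomD(2))

lemma ev1_sum:
  assumes "ishom h"
  shows "ev1 h t p = (\<Sum>i\<le>degree p. h (coeff p i) * t ^ i)"
proof -
  have "poly (map_poly h p) t = (\<Sum>i\<le>degree p. coeff (map_poly h p) i * t ^ i)"
    unfolding poly_altdef
    by (rule sum.mono_neutral_left) (auto simp: coeff_eq_0 map_poly_degree_leq)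
  then show ?thesis
    using assms by (simp add: ev1_def coeff_map_poly ishomD(1))
qed

lemma hom_ev1:
  assumes "ishom g" "ishom h"
  shows "g (ev1 h t p) = ev1 (\<lambda>x. g (h x)) (g t) p"
proof -
  have "ishom (\<lambda>x. g (h x))"
    using assms by (simp add: ishom_def)
  then show ?thesis
    by (induction p) (simp_all add: ev1_pCons ev1_0 ishomD[OF assms(1)] assms(2))
qed

lemma ishom_const: "ishom (\<lambda>c. [:c:])"
  by (simp add: ishom_def flip: one_pCons)

lemma ishom_const2: "ishom (\<lambda>c. [:[:c:]:])"
  by (simp add: ishom_def flip: one_pCons)

lemma ishom_const3: "ishom (\<lambda>c. [:[:[:c:]:]:])"
  by (simp add: ishom_def flip: one_pCons)

lemma ev2_psub2:
  assumes "ishom h"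
  shows "ev1 (ev1 h d) t (psub2 p u) = ev1 h (ev1 (ev1 h d) t u) p"
  unfolding psub2_ev1
  by (subst hom_ev1) (auto simp: assms ishom_const2 ev1_pCons ev1_hom ev1_0)

lemma psubst_sum:
  assumes "degree p \<le> n" "F 0 = 0" "T 0 = 0"
  shows "psubst T F p = (\<Sum>i\<le>n. (T ^^ i) (F (coeff p i)))"
proof -
  have T0: "(T ^^ i) 0 = 0" for i
    by (induction i) (simp_all add: assms)
  show ?thesis
    unfolding psubst_def
    by (rule sum.mono_neutral_left) (use assms in \<open>auto simp: coeff_eq_0 T0\<close>)
qed

lemma psubst_0 [simp]: "F 0 = 0 \<Longrightarrow> psubst T F 0 = F 0"
  by (simp add: psubst_def)

lemma pow_additive:
  fixes T :: "'b::ab_group_add \<Rightarrow> 'b"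
  assumes "\<And>x y. T (x + y) = T x + T y"
  shows "(T ^^ i) (x + y) = (T ^^ i) x + (T ^^ i) y"
  by (induction i) (simp_all add: assms)

lemma psubst_add:
  fixes T :: "'b::ab_group_add \<Rightarrow> 'b" and F :: "'a::comm_monoid_add \<Rightarrow> 'b"
  assumes "\<And>x y. F (x + y) = F x + F y" and T: "\<And>x y. T (x + y) = T x + T y"
  shows "psubst T F (p + q) = psubst T F p + psubst T F q"
proof -
  define n where "n = max (degree p) (degree q)"
  have "F 0 = 0" "T 0 = 0"
    using assms(1)[of 0 0] T[of 0 0] by simp_all
  moreover have "degree (p + q) \<le> n" "degree p \<le> n" "degree q \<le> n"
    by (auto simp: n_def degree_add_le_max)
  ultimately show ?thesis
    by (simp add: psubst_sum[of _ n] assms(1) pow_additive[OF T] sum.distrib)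
qed

lemma psubst_plus:
  fixes T :: "'b::ab_group_add \<Rightarrow> 'b" and G H :: "'a::comm_monoid_add \<Rightarrow> 'b"
  assumes T: "\<And>x y. T (x + y) = T x + T y"
  shows "psubst T (\<lambda>x. G x + H x) p = psubst T G p + psubst T H p"
  by (simp add: psubst_def pow_additive[OF T] sum.distrib)

lemma psubst_single:
  assumes h: "ishom h"
    and E: "\<And>x y. E (x + y) = E x + E y"
    and T: "\<And>Q. T (E Q) = E (t * Q)"
    and G: "\<And>p. G (Poly_Mapping.single \<gamma> p) = E (ev1 h d p * Z)"
  shows "psubst T G (map_poly (Poly_Mapping.single \<gamma>) (P :: complex poly poly)) =
    (E (ev1 (ev1 h d) t P * Z) :: 'b::ab_group_add)"
proof -
  have E0: "E 0 = 0"
    using E[of 0 0] by simp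
  have Esum: "E (sum f A) = (\<Sum>x\<in>A. E (f x))" if "finite A" for f and A :: "nat set"
    using that by (induction A) (simp_all add: E E0)
  have Ti: "(T ^^ i) (E Q) = E (t ^ i * Q)" for i Q
    by (induction i) (simp_all add: T algebra_simps)
  have T0: "T 0 = 0" using T[of 0] by (simp add: E0)
  have G0: "G 0 = 0" using G[of 0] by (simp add: E0 ev1_0)
  have "psubst T G (map_poly (Poly_Mapping.single \<gamma>) P) =
      (\<Sum>i\<le>degree P. (T ^^ i) (G (coeff (map_poly (Poly_Mapping.single \<gamma>) P) i)))"
    by (rule psubst_sum) (simp_all add: G0 T0 map_poly_degree_leq)
  also have "\<dots> = (\<Sum>i\<le>degree P. E (t ^ i * (ev1 h d (coeff P i) * Z)))"
    by (simp add: coeff_map_poly G Ti)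
  also have "\<dots> = E (\<Sum>i\<le>degree P. t ^ i * (ev1 h d (coeff P i) * Z))"
    by (simp add: Esum)
  also have "(\<Sum>i\<le>degree P. t ^ i * (ev1 h d (coeff P i) * Z)) = ev1 (ev1 h d) t P * Z"
    unfolding ev1_sum[OF ev1_hom[OF h]] sum_distrib_right by (simp only: mult_ac)
  finally show ?thesis .
qed

lemma map_poly_single_add:
  "map_poly (Poly_Mapping.single \<gamma>) (x + y) =
    map_poly (Poly_Mapping.single \<gamma>) x + map_poly (Poly_Mapping.single \<gamma>) y"
  by (rule poly_eqI) (simp add: coeff_map_poly single_add)

lemma map_poly_single_uminus:
  "map_poly (Poly_Mapping.single \<gamma>) (- x) = - map_poly (Poly_Mapping.single \<gamma>) (x :: 'a::ab_group_add poly)"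
  by (rule poly_eqI) (simp add: coeff_map_poly single_uminus)

lemma map_poly_single_mult:
  "pCons 0 (map_poly (Poly_Mapping.single \<gamma>) Q) = map_poly (Poly_Mapping.single \<gamma>) ([:0, 1:] * Q)"
  for Q :: "complex poly poly"
  by (simp add: map_poly_pCons)

lemma map_poly_single_dact:
  "map_poly (Poly_Mapping.map ((*) p)) (map_poly (Poly_Mapping.single \<gamma>) Q) =
    map_poly (Poly_Mapping.single \<gamma>) ([:p:] * Q)"
  for Q :: "complex poly poly" and \<gamma> :: complex
  by (rule poly_eqI) (simp add: coeff_map_poly mult_map_scale_conv_mult mult_single)

definition EE :: "complex \<Rightarrow> complex poly poly poly \<Rightarrow> (complex \<Rightarrow>\<^sub>0 complex poly) poly poly" where
  "EE \<gamma> = map_poly (map_poly (Poly_Mapping.single \<gamma>))"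

lemma EE_add: "EE \<gamma> (x + y) = EE \<gamma> x + EE \<gamma> y"
  by (rule poly_eqI) (simp add: EE_def coeff_map_poly map_poly_single_add)

lemma EE_lam: "mult_lam (EE \<gamma> Q) = EE \<gamma> ([:[:0, 1:]:] * Q)"
  by (rule poly_eqI) (simp add: EE_def mult_lam_def coeff_map_poly map_poly_single_mult)

lemma EE_mu: "mult_mu (EE \<gamma> Q) = EE \<gamma> ([:0, 1:] * Q)"
  by (simp add: EE_def mult_mu_def map_poly_pCons)

lemma EE_lam_mu: "mult_lam_mu (EE \<gamma> Q) = EE \<gamma> (([:[:0, 1:]:] + [:0, 1:]) * Q)"
  by (simp only: mult_lam_mu_def EE_lam EE_mu EE_add distrib_right)

lemma mult_lam_add: "mult_lam (x + y) = mult_lam x + mult_lam y"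
  by (rule poly_eqI) (simp add: mult_lam_def coeff_map_poly)

lemma mult_mu_add: "mult_mu (x + y) = mult_mu x + mult_mu y"
  by (simp add: mult_mu_def)

lemma mult_lam_mu_add: "mult_lam_mu (x + y) = mult_lam_mu x + mult_lam_mu y"
  by (simp add: mult_lam_mu_def mult_lam_add mult_mu_add add_ac)

lemma const2_add: "const2 (x + y) = const2 x + const2 y"
  by (simp add: const2_def)

lemma ev1_const_id: "ev1 (\<lambda>c. [:[:[:c:]:]:]) [:[:[:0, 1:]:]:] p = [:[:p:]:]"
  by (induction p) (simp_all add: ev1_0 ev1_pCons ishom_const3)

lemma ev1_const2_id: "ev1 (\<lambda>c. [:[:c:]:]) [:[:0, 1:]:] p = [:p:]"
  by (induction p) (simp_all add: ev1_0 ev1_pCons ishom_const2)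

lemma psubst_const2_single:
  assumes "\<And>Q. T (EE \<gamma> Q) = EE \<gamma> (t * Q)"
  shows "psubst T const2 (map_poly (Poly_Mapping.single \<gamma>) P) =
    EE \<gamma> (ev1 (ev1 (\<lambda>c. [:[:[:c:]:]:]) [:[:[:0, 1:]:]:]) t P)"
proof -
  have "const2 (Poly_Mapping.single \<gamma> p) =
      EE \<gamma> (ev1 (\<lambda>c. [:[:[:c:]:]:]) [:[:[:0, 1:]:]:] p * 1)" for p
    by (simp add: ev1_const_id const2_def EE_def map_poly_pCons)
  from psubst_single[OF ishom_const3 EE_add assms this] show ?thesis
    by simp
qed

abbreviation (input) h3 :: "complex \<Rightarrow> complex poly poly poly" where
  "h3 \<equiv> \<lambda>c. [:[:[:c:]:]:]"

abbreviation (input) D3 :: "complex poly poly poly" where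
  "D3 \<equiv> [:[:[:0, 1:]:]:]"

lemma ev2_X: "ishom h \<Longrightarrow> ev1 (ev1 h d) t [:0, 1:] = t"
  "ishom h \<Longrightarrow> ev1 (ev1 h d) t [:[:0, 1:]:] = d"
  "ishom h \<Longrightarrow> ev1 (ev1 h d) t [:[:c:]:] = h c"
  by (simp_all add: ev1_pCons ev1_hom ev1_0 ishomD)

lemma psubst_CL_bracket_single:
  assumes "\<And>Q \<gamma>. T (EE \<gamma> Q) = EE \<gamma> (t * Q)"
  shows "psubst T const2 (CL_bracket b \<phi> (Poly_Mapping.single \<alpha> p) (Poly_Mapping.single \<beta> q)) =
    EE (\<alpha> + \<beta>) (ev1 h3 (- t) p * ev1 h3 (D3 + t) q * ev1 (ev1 h3 D3) t (CL_coeff b \<phi> \<alpha> \<beta>))"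
proof -
  note hh = ev1_hom[OF ev1_hom[OF ishom_const3]]
  show ?thesis
    unfolding CL_bracket_single psubst_const2_single[OF assms]
    by (simp only: ishomD(4)[OF hh] ev2_psub2[OF ishom_const3] ishomD(5)[OF hh] ishomD(3)[OF hh]
        ev2_X[OF ishom_const3])
qed

lemma nest_left:
  assumes T: "\<And>Q \<gamma>. T (EE \<gamma> Q) = EE \<gamma> (t * Q)" and T': "\<And>Q \<gamma>. T' (EE \<gamma> Q) = EE \<gamma> (t' * Q)"
  shows "psubst T (\<lambda>x. psubst T' const2 (CL_bracket b \<phi> x (Poly_Mapping.single \<gamma> r)))
      (CL_bracket b \<phi> (Poly_Mapping.single \<alpha> p) (Poly_Mapping.single \<beta> q)) =
    EE (\<alpha> + \<beta> + \<gamma>)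
      (ev1 h3 (- t) p * ev1 h3 (t - t') q * ev1 h3 (D3 + t') r *
       ev1 (ev1 h3 (- t')) t (CL_coeff b \<phi> \<alpha> \<beta>) * ev1 (ev1 h3 D3) t' (CL_coeff b \<phi> (\<alpha> + \<beta>) \<gamma>))"
proof -
  note hh = ev1_hom[OF ev1_hom[OF ishom_const3]]
  have *: "psubst T' const2 (CL_bracket b \<phi> (Poly_Mapping.single (\<alpha> + \<beta>) s) (Poly_Mapping.single \<gamma> r)) =
      EE (\<alpha> + \<beta> + \<gamma>) (ev1 h3 (- t') s *
        (ev1 h3 (D3 + t') r * ev1 (ev1 h3 D3) t' (CL_coeff b \<phi> (\<alpha> + \<beta>) \<gamma>)))" for s
    using psubst_CL_bracket_single[OF T'] by (simp only: mult.assoc)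
  have m: "- t' + t = t - t'" by simp
  show ?thesis
    unfolding CL_bracket_single[of b \<phi> \<alpha> p \<beta> q] psubst_single[OF ishom_const3 EE_add T *]
    by (simp only: ishomD(4)[OF hh] ev2_psub2[OF ishom_const3] ishomD(5)[OF hh] ishomD(3)[OF hh]
        ev2_X[OF ishom_const3] mult_ac m)
qed

lemma nest_right:
  assumes T: "\<And>Q \<gamma>. T (EE \<gamma> Q) = EE \<gamma> (t * Q)" and T': "\<And>Q \<gamma>. T' (EE \<gamma> Q) = EE \<gamma> (t' * Q)"
  shows "psubst T (\<lambda>x. psubst T' const2 (CL_bracket b \<phi> (Poly_Mapping.single \<alpha> p) x))
      (CL_bracket b \<phi> (Poly_Mapping.single \<beta> q) (Poly_Mapping.single \<gamma> r)) =
    EE (\<alpha> + \<beta> + \<gamma>)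
      (ev1 h3 (- t') p * ev1 h3 (- t) q * ev1 h3 (D3 + (t' + t)) r *
       ev1 (ev1 h3 (D3 + t')) t (CL_coeff b \<phi> \<beta> \<gamma>) * ev1 (ev1 h3 D3) t' (CL_coeff b \<phi> \<alpha> (\<beta> + \<gamma>)))"
proof -
  note hh = ev1_hom[OF ev1_hom[OF ishom_const3]]
  have *: "psubst T' const2 (CL_bracket b \<phi> (Poly_Mapping.single \<alpha> p) (Poly_Mapping.single (\<beta> + \<gamma>) s)) =
      EE (\<alpha> + \<beta> + \<gamma>) (ev1 h3 (D3 + t') s *
        (ev1 h3 (- t') p * ev1 (ev1 h3 D3) t' (CL_coeff b \<phi> \<alpha> (\<beta> + \<gamma>))))" for s
    using psubst_CL_bracket_single[OF T', of b \<phi> \<alpha> p "\<beta> + \<gamma>" s] by (simp only: mult_ac add_ac)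
  have m: "D3 + t' + t = D3 + (t' + t)" by simp
  show ?thesis
    unfolding CL_bracket_single[of b \<phi> \<beta> q \<gamma> r] psubst_single[OF ishom_const3 EE_add T *]
    by (simp only: ishomD(4)[OF hh] ev2_psub2[OF ishom_const3] ishomD(5)[OF hh] ishomD(3)[OF hh]
        ev2_X[OF ishom_const3] mult_ac m)
qed

lemma CL_coeff_ev2:
  assumes "ishom h"
  shows "ev1 (ev1 h d) t (CL_coeff b \<phi> \<alpha> \<beta>) =
    h (\<alpha> + b) * d + h (\<alpha> + \<beta> + 2 * b) * t +
    h (1 / b * (\<phi> \<alpha> * \<beta> - \<phi> \<beta> * \<alpha> + b * (\<phi> \<alpha> - \<phi> \<beta>)))"
  using ev1_hom[OF ev1_hom[OF assms]]
  by (simp add: CL_coeff_def ishomD ev2_X[OF assms] del: mult_pCons_left mult_pCons_right add_pCons)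

lemma jacobi_algebra:
  fixes A B C p q r i :: "'r::idom"
  assumes i: "i * b = 1"
  shows "((B + b) * (D + l) + (B + C + (b + b)) * m + i * (q * C - r * B + b * (q - r))) *
      ((A + b) * D + (A + (B + C) + (b + b)) * l + i * (p * (B + C) - (q + r) * A + b * (p - (q + r)))) =
    ((A + b) * (- (l + m)) + (A + B + (b + b)) * l + i * (p * B - q * A + b * (p - q))) *
      ((A + B + b) * D + (A + B + C + (b + b)) * (l + m) + i * ((p + q) * C - r * (A + B) + b * (p + q - r))) +
    ((A + b) * (D + m) + (A + C + (b + b)) * l + i * (p * C - r * A + b * (p - r))) *
      ((B + b) * D + (B + (A + C) + (b + b)) * m + i * (q * (A + C) - (p + r) * B + b * (q - (p + r))))"
proof -
  have w: "i * (x * Y - y * X + b * (x - y)) = x * (i * Y + 1) - y * (i * X + 1)" for x y X Y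
  proof -
    have "i * (x * Y - y * X + b * (x - y)) = i * (x * Y - y * X) + (i * b) * (x - y)"
      by (simp add: algebra_simps)
    then show ?thesis by (simp only: i) (simp add: algebra_simps)
  qed
  show ?thesis
    unfolding w using i by algebra
qed

lemma jacobi_scalar:
  fixes h :: "complex \<Rightarrow> 'r::idom"
  assumes h: "ishom h" and "b \<noteq> 0"
    and \<phi>: "\<phi> (\<beta> + \<gamma>) = \<phi> \<beta> + \<phi> \<gamma>" "\<phi> (\<alpha> + \<beta>) = \<phi> \<alpha> + \<phi> \<beta>" "\<phi> (\<alpha> + \<gamma>) = \<phi> \<alpha> + \<phi> \<gamma>"
  shows "ev1 (ev1 h (D + l)) m (CL_coeff b \<phi> \<beta> \<gamma>) * ev1 (ev1 h D) l (CL_coeff b \<phi> \<alpha> (\<beta> + \<gamma>)) =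
    ev1 (ev1 h (- (l + m))) l (CL_coeff b \<phi> \<alpha> \<beta>) * ev1 (ev1 h D) (l + m) (CL_coeff b \<phi> (\<alpha> + \<beta>) \<gamma>) +
    ev1 (ev1 h (D + m)) l (CL_coeff b \<phi> \<alpha> \<gamma>) * ev1 (ev1 h D) m (CL_coeff b \<phi> \<beta> (\<alpha> + \<gamma>))"
proof -
  note hs = ishomD[OF h]
  define i where "i = h (1 / b)"
  have i: "i * h b = 1"
    using \<open>b \<noteq> 0\<close> by (simp add: i_def flip: hs(4)) (simp add: hs(2))
  have h2: "h (2 * b) = h b + h b"
    using hs(3)[of b b] by (simp only: mult_2)
  show ?thesis
    unfolding CL_coeff_ev2[OF h] \<phi> hs(3) h2 unfolding hs i_def[symmetric]
    by (rule jacobi_algebra[OF i])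
qed

lemma CL_jacobi_single:
  assumes "b \<noteq> 0"
    and "\<phi> (\<beta> + \<gamma>) = \<phi> \<beta> + \<phi> \<gamma>" "\<phi> (\<alpha> + \<beta>) = \<phi> \<alpha> + \<phi> \<beta>" "\<phi> (\<alpha> + \<gamma>) = \<phi> \<alpha> + \<phi> \<gamma>"
  shows "conformal_leibniz (CL \<Delta> b \<phi>) (CL_bracket b \<phi> (Poly_Mapping.single \<alpha> p))
    (Poly_Mapping.single \<beta> q) (Poly_Mapping.single \<gamma> r)"
proof -
  let ?l = "[:[:0, 1:]:] :: complex poly poly poly" and ?m = "[:0, 1:] :: complex poly poly poly"
  note j = jacobi_scalar[OF ishom_const3 assms, of D3 ?l ?m]
  have m: "?l - (?l + ?m) = - ?m" by simp
  have g: "\<beta> + \<alpha> + \<gamma> = \<alpha> + \<beta> + \<gamma>" "?m + ?l = ?l + ?m" by simp_all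
  show ?thesis
    unfolding conformal_leibniz_def CL_simps
      nest_right[OF EE_mu EE_lam] nest_left[OF EE_lam EE_lam_mu] nest_right[OF EE_lam EE_mu]
      EE_add[symmetric] m g
    by (rule arg_cong[where f = "EE (\<alpha> + \<beta> + \<gamma>)"])
      (use j in algebra)
qed

lemma CL_bracket_superset:
  assumes "finite A" "finite B" "Poly_Mapping.keys u \<subseteq> A" "Poly_Mapping.keys v \<subseteq> B"
  shows "CL_bracket b \<phi> u v = (\<Sum>\<alpha>\<in>A. \<Sum>\<beta>\<in>B. CL_bracket b \<phi>
    (Poly_Mapping.single \<alpha> (Poly_Mapping.lookup u \<alpha>)) (Poly_Mapping.single \<beta> (Poly_Mapping.lookup v \<beta>)))"
proof -
  have "CL_bracket b \<phi> u v = (\<Sum>\<alpha>\<in>Poly_Mapping.keys u. \<Sum>\<beta>\<in>B. CL_bracket b \<phi>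
      (Poly_Mapping.single \<alpha> (Poly_Mapping.lookup u \<alpha>)) (Poly_Mapping.single \<beta> (Poly_Mapping.lookup v \<beta>)))"
    unfolding CL_bracket_single unfolding CL_bracket_def
    by (intro sum.cong sum.mono_neutral_left) (use assms in \<open>auto simp: not_in_keys_iff_lookup_eq_zero\<close>)
  also have "\<dots> = (\<Sum>\<alpha>\<in>A. \<Sum>\<beta>\<in>B. CL_bracket b \<phi>
      (Poly_Mapping.single \<alpha> (Poly_Mapping.lookup u \<alpha>)) (Poly_Mapping.single \<beta> (Poly_Mapping.lookup v \<beta>)))"
    unfolding CL_bracket_single
    by (intro sum.mono_neutral_left) (use assms in \<open>auto simp: not_in_keys_iff_lookup_eq_zero\<close>)
  finally show ?thesis .
qed

lemma CL_bracket_add_left: "CL_bracket b \<phi> (u + u') v = CL_bracket b \<phi> u v + CL_bracket b \<phi> u' v"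
proof -
  define A where "A = Poly_Mapping.keys u \<union> Poly_Mapping.keys u'"
  have "finite A" "Poly_Mapping.keys u \<subseteq> A" "Poly_Mapping.keys u' \<subseteq> A" "Poly_Mapping.keys (u + u') \<subseteq> A"
    using keys_add[of u u'] by (auto simp: A_def)
  then show ?thesis
    by (simp add: CL_bracket_superset[where A = A and B = "Poly_Mapping.keys v"] CL_bracket_single
        lookup_add psub2_ev1 ev1_add[OF ishom_const2] map_poly_single_add sum.distrib distrib_right
        del: mult_pCons_left mult_pCons_right add_pCons)
qed

lemma CL_bracket_add_right: "CL_bracket b \<phi> v (u + u') = CL_bracket b \<phi> v u + CL_bracket b \<phi> v u'"
proof -
  define A where "A = Poly_Mapping.keys u \<union> Poly_Mapping.keys u'"
  have "finite A" "Poly_Mapping.keys u \<subseteq> A" "Poly_Mapping.keys u' \<subseteq> A" "Poly_Mapping.keys (u + u') \<subseteq> A"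
    using keys_add[of u u'] by (auto simp: A_def)
  then show ?thesis
    by (simp add: CL_bracket_superset[where A = "Poly_Mapping.keys v" and B = A] CL_bracket_single
        lookup_add psub2_ev1 ev1_add[OF ishom_const2] map_poly_single_add sum.distrib
        distrib_right distrib_left
        del: mult_pCons_left mult_pCons_right add_pCons)
qed

lemma keys_additive_induct:
  assumes "Poly_Mapping.keys u \<subseteq> \<Delta>"
    and 0: "P 0"
    and single: "\<And>\<alpha> p. \<alpha> \<in> \<Delta> \<Longrightarrow> P (Poly_Mapping.single \<alpha> p)"
    and add: "\<And>u v. P u \<Longrightarrow> P v \<Longrightarrow> P (u + v)"
  shows "P (u :: 'k \<Rightarrow>\<^sub>0 'a::comm_monoid_add)"
proof -
  have "u = (\<Sum>\<alpha>\<in>Poly_Mapping.keys u. Poly_Mapping.single \<alpha> (Poly_Mapping.lookup u \<alpha>))"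
    by (rule poly_mapping_eqI)
      (auto simp: lookup_sum lookup_single when_def not_in_keys_iff_lookup_eq_zero sum.If_cases if_distrib sum.delta)
  moreover have "P (\<Sum>\<alpha>\<in>A. Poly_Mapping.single \<alpha> (Poly_Mapping.lookup u \<alpha>))"
    if "finite A" "A \<subseteq> \<Delta>" for A
    using that by (induction A) (auto intro: 0 single add)
  ultimately show ?thesis
    using assms(1) by (metis finite_keys)
qed

lemma CL_jacobi:
  assumes b: "b \<noteq> 0" and \<phi>: "\<And>\<alpha> \<beta>. \<alpha> \<in> \<Delta> \<Longrightarrow> \<beta> \<in> \<Delta> \<Longrightarrow> \<phi> (\<alpha> + \<beta>) = \<phi> \<alpha> + \<phi> \<beta>"
    and "Poly_Mapping.keys u \<subseteq> \<Delta>" "Poly_Mapping.keys v \<subseteq> \<Delta>" "Poly_Mapping.keys w \<subseteq> \<Delta>"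
  shows "conformal_leibniz (CL \<Delta>' b \<phi>) (CL_bracket b \<phi> u) v w"
proof -
  define J where "J u v w = 
      psubst mult_lam (\<lambda>x. psubst mult_lam_mu const2 (CL_bracket b \<phi> x w)) (CL_bracket b \<phi> u v) +
      psubst mult_lam (\<lambda>x. psubst mult_mu const2 (CL_bracket b \<phi> v x)) (CL_bracket b \<phi> u w) -
      psubst mult_mu (\<lambda>x. psubst mult_lam const2 (CL_bracket b \<phi> u x)) (CL_bracket b \<phi> v w)" for u v w
  have J: "conformal_leibniz (CL \<Delta>' b \<phi>) (CL_bracket b \<phi> u) v w \<longleftrightarrow> J u v w = 0" for u v w
    by (auto simp: conformal_leibniz_def J_def)
  note ad = CL_bracket_add_left CL_bracket_add_right psubst_add mult_lam_add mult_mu_add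
    mult_lam_mu_add const2_add psubst_plus
  have J1: "J (u + u') v w = J u v w + J u' v w" for u u' v w
    unfolding J_def by (simp add: ad)
  have J2: "J u (v + v') w = J u v w + J u v' w" for u v v' w
    unfolding J_def by (simp add: ad)
  have J3: "J u v (w + w') = J u v w + J u v w'" for u v w w'
    unfolding J_def by (simp add: ad)
  have Z: "J 0 v w = 0" "J u 0 w = 0" "J u v 0 = 0" for u v w
    using J1[of 0 0] J2[of _ 0 0] J3[of _ _ 0 0] by simp_all
  have "J (Poly_Mapping.single \<alpha> p) (Poly_Mapping.single \<beta> q) (Poly_Mapping.single \<gamma> r) = 0"
    if "\<alpha> \<in> \<Delta>" "\<beta> \<in> \<Delta>" "\<gamma> \<in> \<Delta>" for \<alpha> p \<beta> q \<gamma> r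
    unfolding J[symmetric] using that by (intro CL_jacobi_single b \<phi>)
  then have "J (Poly_Mapping.single \<alpha> p) (Poly_Mapping.single \<beta> q) w = 0"
    if "\<alpha> \<in> \<Delta>" "\<beta> \<in> \<Delta>" for \<alpha> p \<beta> q
    using assms(5) that by (elim keys_additive_induct) (simp_all add: Z J3)
  then have "J (Poly_Mapping.single \<alpha> p) v w = 0" if "\<alpha> \<in> \<Delta>" for \<alpha> p
    using assms(4) that by (elim keys_additive_induct) (simp_all add: Z J2)
  then have "J u v w = 0"
    using assms(3) by (elim keys_additive_induct) (simp_all add: Z J1)
  then show ?thesis
    by (simp add: J)
qed

lemma map_mult_single:
  "Poly_Mapping.map ((*) (p :: complex poly)) (Poly_Mapping.single \<alpha> q) = Poly_Mapping.single \<alpha> (p * q)"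
  by (simp add: mult_map_scale_conv_mult mult_single)

lemma map_mult_add:
  "Poly_Mapping.map ((*) p) (u + v :: complex \<Rightarrow>\<^sub>0 complex poly) =
    Poly_Mapping.map ((*) p) u + Poly_Mapping.map ((*) p) v"
  by (simp add: mult_map_scale_conv_mult distrib_left)

lemma map_mult_0: "Poly_Mapping.map ((*) p) (0 :: complex \<Rightarrow>\<^sub>0 complex poly) = 0"
  by (simp add: mult_map_scale_conv_mult)

lemma map_poly_map_mult_add:
  "map_poly (Poly_Mapping.map ((*) p)) (u + v :: (complex \<Rightarrow>\<^sub>0 complex poly) poly) =
    map_poly (Poly_Mapping.map ((*) p)) u + map_poly (Poly_Mapping.map ((*) p)) v"
  by (rule poly_eqI) (simp add: coeff_map_poly map_mult_add map_mult_0)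

lemma additive_ext2:
  fixes F G :: "(complex \<Rightarrow>\<^sub>0 complex poly) \<Rightarrow> (complex \<Rightarrow>\<^sub>0 complex poly) \<Rightarrow> 'b::ab_group_add"
  assumes F: "\<And>u u' v. F (u + u') v = F u v + F u' v" "\<And>u v v'. F u (v + v') = F u v + F u v'"
    and G: "\<And>u u' v. G (u + u') v = G u v + G u' v" "\<And>u v v'. G u (v + v') = G u v + G u v'"
    and "\<And>\<alpha> p \<beta> q. F (Poly_Mapping.single \<alpha> p) (Poly_Mapping.single \<beta> q) =
      G (Poly_Mapping.single \<alpha> p) (Poly_Mapping.single \<beta> q)"
  shows "F u v = G u v"
proof -
  have Z: "F 0 v = 0" "F u 0 = 0" "G 0 v = 0" "G u 0 = 0" for u v
    using F(1)[of 0 0] F(2)[of _ 0 0] G(1)[of 0 0] G(2)[of _ 0 0] by simp_all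
  have "F (Poly_Mapping.single \<alpha> p) v = G (Poly_Mapping.single \<alpha> p) v" for \<alpha> p
    by (induction v rule: keys_additive_induct[where \<Delta> = UNIV]) (simp_all add: Z F G assms(5))
  then show ?thesis
    by (induction u rule: keys_additive_induct[where \<Delta> = UNIV]) (simp_all add: Z F G)
qed

lemma ev1_X: "ishom h \<Longrightarrow> ev1 h t [:0, 1:] = t"
  by (simp add: ev1_pCons ev1_0 ishomD)

lemma psub2_mult: "psub2 (p * q) t = psub2 p t * psub2 q t"
  by (simp only: psub2_ev1 ishomD(4)[OF ev1_hom[OF ishom_const2]])

lemma psub2_X: "psub2 [:0, 1:] t = t"
  by (simp only: psub2_ev1 ev1_X[OF ishom_const2])

lemma pCons_additive: "pCons (0 :: 'a::comm_monoid_add) (x + y) = pCons 0 x + pCons 0 y"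
  by simp

lemmas CL_additive = map_mult_add CL_bracket_add_left CL_bracket_add_right map_poly_map_mult_add
  pCons_additive minus_add_distrib

lemmas CL_on_single = map_mult_single CL_bracket_single map_poly_single_dact map_poly_single_mult
  psub2_mult psub2_const psub2_X map_poly_single_add[symmetric] map_poly_single_uminus[symmetric]

lemma CL_bracket_cact_left:
  "CL_bracket b \<phi> (Poly_Mapping.map ((*) [:k:]) u) v =
    map_poly (Poly_Mapping.map ((*) [:k:])) (CL_bracket b \<phi> u v)"
proof (rule additive_ext2[where u = u and v = v])
  fix \<alpha> p \<beta> q
  show "CL_bracket b \<phi> (Poly_Mapping.map ((*) [:k:]) (Poly_Mapping.single \<alpha> p)) (Poly_Mapping.single \<beta> q) =
    map_poly (Poly_Mapping.map ((*) [:k:])) (CL_bracket b \<phi> (Poly_Mapping.single \<alpha> p) (Poly_Mapping.single \<beta> q))"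
    by (simp only: CL_on_single) (rule arg_cong[where f = "map_poly _"], algebra)
qed (simp_all only: CL_additive)

lemma CL_bracket_cact_right:
  "CL_bracket b \<phi> u (Poly_Mapping.map ((*) [:k:]) v) =
    map_poly (Poly_Mapping.map ((*) [:k:])) (CL_bracket b \<phi> u v)"
proof (rule additive_ext2[where u = u and v = v])
  fix \<alpha> p \<beta> q
  show "CL_bracket b \<phi> (Poly_Mapping.single \<alpha> p) (Poly_Mapping.map ((*) [:k:]) (Poly_Mapping.single \<beta> q)) =
    map_poly (Poly_Mapping.map ((*) [:k:])) (CL_bracket b \<phi> (Poly_Mapping.single \<alpha> p) (Poly_Mapping.single \<beta> q))"
    by (simp only: CL_on_single) (rule arg_cong[where f = "map_poly _"], algebra)
qed (simp_all only: CL_additive)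

lemma CL_bracket_dact_left:
  "CL_bracket b \<phi> (Poly_Mapping.map ((*) [:0, 1:]) u) v = - pCons 0 (CL_bracket b \<phi> u v)"
proof (rule additive_ext2[where u = u and v = v])
  fix \<alpha> p \<beta> q
  show "CL_bracket b \<phi> (Poly_Mapping.map ((*) [:0, 1:]) (Poly_Mapping.single \<alpha> p)) (Poly_Mapping.single \<beta> q) =
    - pCons 0 (CL_bracket b \<phi> (Poly_Mapping.single \<alpha> p) (Poly_Mapping.single \<beta> q))"
    by (simp only: CL_on_single mult_minus_left mult.assoc)
qed (simp_all only: CL_additive add_ac)

lemma CL_bracket_dact_right:
  "CL_bracket b \<phi> u (Poly_Mapping.map ((*) [:0, 1:]) v) =
    pCons 0 (CL_bracket b \<phi> u v) + map_poly (Poly_Mapping.map ((*) [:0, 1:])) (CL_bracket b \<phi> u v)"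
proof (rule additive_ext2[where u = u and v = v])
  fix \<alpha> p \<beta> q
  show "CL_bracket b \<phi> (Poly_Mapping.single \<alpha> p) (Poly_Mapping.map ((*) [:0, 1:]) (Poly_Mapping.single \<beta> q)) =
    pCons 0 (CL_bracket b \<phi> (Poly_Mapping.single \<alpha> p) (Poly_Mapping.single \<beta> q)) +
    map_poly (Poly_Mapping.map ((*) [:0, 1:])) (CL_bracket b \<phi> (Poly_Mapping.single \<alpha> p) (Poly_Mapping.single \<beta> q))"
    by (simp only: CL_on_single) (rule arg_cong[where f = "map_poly _"], algebra)
qed (simp_all only: CL_additive add_ac)

lemma CL_bracket_skew:
  assumes "b \<noteq> 0"
  shows "CL_bracket b \<phi> u v =
    - psubst (\<lambda>P. - pCons 0 P - map_poly (Poly_Mapping.map ((*) [:0, 1:])) P) (\<lambda>r. [:r:]) (CL_bracket b \<phi> v u)"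
    (is "_ = - psubst ?T _ _")
proof (rule additive_ext2[where u = u and v = v])
  have T: "?T (x + y) = ?T x + ?T y" for x y
    by (simp only: CL_additive) simp
  have c: "[:x + y:] = [:x:] + [:y:]" for x y :: "complex \<Rightarrow>\<^sub>0 complex poly"
    by simp
  note ad = CL_additive psubst_add[where T = ?T, OF c T]
  show "- psubst ?T (\<lambda>r. [:r:]) (CL_bracket b \<phi> v (u + u')) =
      - psubst ?T (\<lambda>r. [:r:]) (CL_bracket b \<phi> v u) + - psubst ?T (\<lambda>r. [:r:]) (CL_bracket b \<phi> v u')" for u u' v
    by (simp only: ad)
  show "- psubst ?T (\<lambda>r. [:r:]) (CL_bracket b \<phi> (v + v') u) =
      - psubst ?T (\<lambda>r. [:r:]) (CL_bracket b \<phi> v u) + - psubst ?T (\<lambda>r. [:r:]) (CL_bracket b \<phi> v' u)" for u v v'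
    by (simp only: ad)
  fix \<alpha> p \<beta> q
  let ?D = "[:[:0, 1:]:] :: complex poly poly" and ?l = "[:0, 1:] :: complex poly poly"
  let ?h = "\<lambda>c. [:[:c:]:] :: complex poly poly"
  note hh = ev1_hom[OF ev1_hom[OF ishom_const2]]
  have T1: "?T (map_poly (Poly_Mapping.single (\<alpha> + \<beta>)) Q) =
      map_poly (Poly_Mapping.single (\<alpha> + \<beta>)) ((- ?l - ?D) * Q)" for Q
    by (simp only: CL_on_single distrib_right mult_minus_left diff_conv_add_uminus)
  have G: "[:Poly_Mapping.single (\<alpha> + \<beta>) s:] =
      map_poly (Poly_Mapping.single (\<alpha> + \<beta>)) (ev1 ?h ?D s * 1)" for s
    by (simp add: ev1_const2_id map_poly_pCons)
  have i: "1 / b * b = 1" using assms by simp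
  have scal: "ev1 (ev1 ?h ?D) (- ?l - ?D) (CL_coeff b \<phi> \<beta> \<alpha>) = - CL_coeff b \<phi> \<alpha> \<beta>"
  proof -
    define w where "w = 1 / b * (\<phi> \<alpha> * \<beta> - \<phi> \<beta> * \<alpha> + b * (\<phi> \<alpha> - \<phi> \<beta>))"
    have w: "1 / b * (\<phi> \<beta> * \<alpha> - \<phi> \<alpha> * \<beta> + b * (\<phi> \<beta> - \<phi> \<alpha>)) = - w"
      unfolding w_def mult_minus_right[symmetric]
      by (rule arg_cong[where f = "(*) (1 / b)"]) (simp add: algebra_simps)
    show ?thesis
      unfolding CL_coeff_ev2[OF ishom_const2] w unfolding CL_coeff_def w_def[symmetric]
      by (simp add: algebra_simps)
  qed
  have m: "?D + (- ?l - ?D) = - ?l" "- (- ?l - ?D) = ?D + ?l" by simp_all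
  show "CL_bracket b \<phi> (Poly_Mapping.single \<alpha> p) (Poly_Mapping.single \<beta> q) =
    - psubst ?T (\<lambda>r. [:r:]) (CL_bracket b \<phi> (Poly_Mapping.single \<beta> q) (Poly_Mapping.single \<alpha> p))"
    unfolding CL_bracket_single[of _ _ \<beta>] add.commute[of \<beta> \<alpha>]
      psubst_single[OF ishom_const2 map_poly_single_add T1 G]
    by (simp only: ishomD(4)[OF hh] ev2_psub2[OF ishom_const2] ishomD(5)[OF hh] ishomD(3)[OF hh]
        ev2_X[OF ishom_const2] scal m CL_bracket_single)
      (simp only: psub2_ev1 map_poly_single_uminus[symmetric] mult_minus_right minus_minus mult_1_right,
        rule arg_cong[where f = "map_poly _"], algebra)
qed (simp_all only: CL_additive)

lemma CL_bracket_closed: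
  assumes "\<And>\<alpha> \<beta>. \<alpha> \<in> \<Delta> \<Longrightarrow> \<beta> \<in> \<Delta> \<Longrightarrow> \<alpha> + \<beta> \<in> \<Delta>"
    and "Poly_Mapping.keys u \<subseteq> \<Delta>" "Poly_Mapping.keys v \<subseteq> \<Delta>"
  shows "Poly_Mapping.keys (coeff (CL_bracket b \<phi> u v) i) \<subseteq> \<Delta>"
  unfolding CL_bracket_def coeff_sum
  by (intro order_trans[OF keys_sum] UN_least) (use assms in \<open>auto simp: coeff_map_poly split: if_splits\<close>)

lemma lie_conformal_algebra_CL:
  assumes "0 \<in> \<Delta>"
    and "\<And>\<alpha> \<beta>. \<alpha> \<in> \<Delta> \<Longrightarrow> \<beta> \<in> \<Delta> \<Longrightarrow> \<alpha> + \<beta> \<in> \<Delta>"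
    and "2 * b \<notin> \<Delta>"
    and "\<And>\<alpha> \<beta>. \<alpha> \<in> \<Delta> \<Longrightarrow> \<beta> \<in> \<Delta> \<Longrightarrow> \<phi> (\<alpha> + \<beta>) = \<phi> \<alpha> + \<phi> \<beta>"
  shows "lie_conformal_algebra (CL \<Delta> b \<phi>)"
proof -
  have b: "b \<noteq> 0" using assms(1,3) by auto
  have mod: "module (\<lambda>p. Poly_Mapping.map ((*) p) :: (complex \<Rightarrow>\<^sub>0 complex poly) \<Rightarrow> _)"
    by unfold_locales
      (simp_all add: mult_map_scale_conv_mult distrib_left distrib_right single_add mult_single
        flip: mult.assoc)
  have sub: "module.subspace (\<lambda>p. Poly_Mapping.map ((*) p)) {u :: complex \<Rightarrow>\<^sub>0 complex poly. Poly_Mapping.keys u \<subseteq> \<Delta>}"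
    unfolding module.subspace_def[OF mod]
  proof (intro conjI ballI allI)
    show "p + q \<in> {u. Poly_Mapping.keys u \<subseteq> \<Delta>}"
      if "p \<in> {u. Poly_Mapping.keys u \<subseteq> \<Delta>}" "q \<in> {u. Poly_Mapping.keys u \<subseteq> \<Delta>}"
      for p q :: "complex \<Rightarrow>\<^sub>0 complex poly"
      using that keys_add[of p q] by auto
    show "Poly_Mapping.map ((*) c) q \<in> {u. Poly_Mapping.keys u \<subseteq> \<Delta>}"
      if "q \<in> {u. Poly_Mapping.keys u \<subseteq> \<Delta>}" for c and q :: "complex \<Rightarrow>\<^sub>0 complex poly"
      using that by (auto simp: in_keys_iff map.rep_eq when_def split: if_splits)
  qed simp
  show ?thesis
    unfolding lie_conformal_algebra_def dact_def cact_def CL_simps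
    using mod sub b CL_bracket_closed[OF assms(2)] CL_jacobi[OF b assms(4)]
    by (intro conjI ballI allI; simp only: mem_Collect_eq CL_bracket_add_left CL_bracket_add_right
        CL_bracket_cact_left CL_bracket_cact_right CL_bracket_dact_left CL_bracket_dact_right
        CL_bracket_skew[OF b, symmetric])
qed

end

theory Submission
  imports Defs
begin

text \<open>
  That inner derivations are conformal derivations is the Jacobi identity
  (\<open>CInn_subset_CDer\<close>). For the converse let \<open>d\<close> be a conformal derivation and write
  \<open>d\<^sub>\<lambda> x\<^sub>\<beta> = \<Sum>\<^sub>\<gamma> f\<^bsub>\<gamma>,\<beta>\<^esub>(\<partial>, \<lambda>) x\<^bsub>\<gamma>+\<beta>\<^esub>\<close>
  and \<open>[x\<^sub>\<gamma> \<^sub>\<lambda> x\<^sub>\<beta>] = C\<^bsub>\<gamma>,\<beta>\<^esub>(\<partial>, \<lambda>) x\<^bsub>\<gamma>+\<beta>\<^esub>\<close>.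

  The whole argument rests on the single element \<open>x\<^sub>0\<close> and the single value \<open>\<mu> = 0\<close>: the zeroth
  product \<open>[x\<^sub>0 \<^sub>\<mu> \<cdot>]\<close> at \<open>\<mu> = 0\<close> is diagonal and multiplies \<open>x\<^sub>\<beta>\<close> by \<open>b\<partial> - \<phi>(\<beta>)\<close>. Apply \<open>d\<close> to
  \<open>[x\<^sub>0 \<^sub>\<mu> x\<^sub>\<beta>]\<close>, put \<open>\<mu> = 0\<close> and compare coefficients of \<open>x\<^bsub>\<gamma>+\<beta>\<^esub>\<close>. On the left \<open>d\<^sub>\<lambda>\<close> turns
  \<open>b\<partial> - \<phi>(\<beta>)\<close> into \<open>b(\<partial> + \<lambda>) - \<phi>(\<beta>)\<close>; on the right the zeroth product contributes
  \<open>b\<partial> - \<phi>(\<beta> + \<gamma>)\<close>. The terms in \<open>\<partial>\<close> cancel, which leaves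
  (\<open>derivation_component_equation\<close>)
  \<open>(b\<lambda> + \<phi>(\<gamma>)) f\<^bsub>\<gamma>,\<beta>\<^esub>(\<partial>, \<lambda>) = f\<^bsub>\<gamma>,0\<^esub>(-\<lambda>, \<lambda>) C\<^bsub>\<gamma>,\<beta>\<^esub>(\<partial>, \<lambda>)\<close>.

  Since \<open>2b \<notin> \<Delta>\<close>, also \<open>b \<notin> \<Delta>\<close>, so \<open>b\<close> and \<open>\<gamma> + b\<close> are nonzero. Hence \<open>C\<^bsub>\<gamma>,\<beta>\<^esub>\<close> has degree one in
  \<open>\<partial>\<close> and does not vanish at the root of \<open>b\<lambda> + \<phi>(\<gamma>)\<close>, and the linear factor divides the polynomial
  \<open>f\<^bsub>\<gamma>,0\<^esub>(-\<lambda>, \<lambda>)\<close> in the one variable \<open>\<lambda>\<close>. Writing the quotient as \<open>g\<^sub>\<gamma>(-\<lambda>)\<close> gives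
  \<open>f\<^bsub>\<gamma>,\<beta>\<^esub> = g\<^sub>\<gamma>(-\<lambda>) C\<^bsub>\<gamma>,\<beta>\<^esub>\<close> for all \<open>\<beta>\<close> (\<open>derivation_component_inner\<close>), which is the coefficient
  of \<open>x\<^bsub>\<gamma>+\<beta>\<^esub>\<close> in \<open>[g\<^sub>\<gamma>(\<partial>) x\<^sub>\<gamma> \<^sub>\<lambda> x\<^sub>\<beta>]\<close>. As \<open>g\<^sub>\<gamma>\<close> is computed from \<open>d\<^sub>\<lambda> x\<^sub>0\<close>, only finitely many are
  nonzero, and \<open>d\<close> agrees with the adjoint map of \<open>\<Sum>\<^sub>\<gamma> g\<^sub>\<gamma>(\<partial>) x\<^sub>\<gamma>\<close> on the generators, hence everywhere.
\<close>

section \<open>Inner derivations are derivations\<close>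

lemma psubst_cong:
  "(\<And>i. F (coeff p i) = G (coeff p i)) \<Longrightarrow> psubst T F p = psubst T G p"
  by (simp add: psubst_def)

text \<open>
  The axioms on the second argument of the bracket say that \<open>[a \<^sub>\<lambda> \<cdot>]\<close> is conformal linear, and the
  Jacobi identity is its Leibniz rule.
\<close>

lemma CInn_subset_CDer:
  assumes "lie_conformal_algebra R"
  shows "CInn R \<subseteq> CDer R"
proof
  fix d assume "d \<in> CInn R"
  then obtain a where a: "a \<in> carr R" and d: "d = cad R a"
    by (auto simp: CInn_def)
  note R = assms[unfolded lie_conformal_algebra_def]
  have d_eq: "d x = lbr R a x" if "x \<in> carr R" for x
    using that by (simp add: d cad_def)
  have "\<forall>x\<in>carr R. \<forall>y\<in>carr R. \<forall>i. coeff (lbr R x y) i \<in> carr R"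
    using R by (elim conjE)
  then have coeff_in: "coeff (lbr R x y) i \<in> carr R" if "x \<in> carr R" "y \<in> carr R" for x y i
    using that by blast
  have m: "module (act R)"
    using R by (elim conjE)
  have sub: "module.subspace (act R) (carr R)"
    using R by (elim conjE)
  have closed: "x + y \<in> carr R" "cact R c x \<in> carr R" "dact R x \<in> carr R"
    if "x \<in> carr R" "y \<in> carr R" for x y c
    using sub that by (auto simp: module.subspace_def[OF m] cact_def dact_def)
  have "\<forall>x\<in>carr R. \<forall>y\<in>carr R. \<forall>z\<in>carr R. lbr R x (y + z) = lbr R x y + lbr R x z"
    using R by (elim conjE)
  then have add: "lbr R a (x + y) = lbr R a x + lbr R a y" if "x \<in> carr R" "y \<in> carr R" for x y
    using a that by blast
  have "\<forall>c. \<forall>x\<in>carr R. \<forall>y\<in>carr R. lbr R x (cact R c y) = map_poly (cact R c) (lbr R x y)"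
    using R by (elim conjE)
  then have scale: "lbr R a (cact R c x) = map_poly (cact R c) (lbr R a x)" if "x \<in> carr R" for c x
    using a that by blast
  have "\<forall>x\<in>carr R. \<forall>y\<in>carr R.
      lbr R x (dact R y) = pCons 0 (lbr R x y) + map_poly (dact R) (lbr R x y)"
    using R by (elim conjE)
  then have del: "lbr R a (dact R x) = pCons 0 (lbr R a x) + map_poly (dact R) (lbr R a x)"
    if "x \<in> carr R" for x
    using a that by blast
  have leib: "\<forall>x\<in>carr R. \<forall>y\<in>carr R. \<forall>z\<in>carr R. conformal_leibniz R (lbr R x) y z"
    using R by (elim conjE)
  (* d is undefined off the carrier, so closure of the carrier is needed before each rewriting. *)
  have "conformal_linear R d"
    unfolding conformal_linear_def
    by (simp add: d_eq closed add scale del coeff_in a add.commute)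
  moreover have "conformal_leibniz R d x y" if "x \<in> carr R" "y \<in> carr R" for x y
  proof -
    have "psubst mult_mu (\<lambda>z. psubst mult_lam const2 (d z)) (lbr R x y) =
        psubst mult_mu (\<lambda>z. psubst mult_lam const2 (lbr R a z)) (lbr R x y)"
      by (rule psubst_cong) (simp add: d_eq coeff_in that)
    moreover have "conformal_leibniz R (lbr R a) x y"
      using leib a that by blast
    ultimately show ?thesis
      by (simp add: conformal_leibniz_def d_eq that)
  qed
  moreover have "d \<in> extensional (carr R)"
    by (simp add: d cad_def)
  ultimately show "d \<in> CDer R"
    by (simp add: CDer_def)
qed

section \<open>The Leibniz rule at \<open>\<mu> = 0\<close>\<close>

lemma funpow_mult_lam_coeff: "coeff ((mult_lam ^^ i) P) n = (pCons 0 ^^ i) (coeff P n)"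
proof (induction i arbitrary: n)
  case (Suc i)
  then show ?case
    by (simp add: mult_lam_def coeff_map_poly)
qed simp

lemma funpow_mult_lam_mu_coeff_0: "coeff ((mult_lam_mu ^^ i) P) 0 = (pCons 0 ^^ i) (coeff P 0)"
  by (induction i) (simp_all add: mult_lam_mu_def mult_mu_def mult_lam_def coeff_map_poly)

lemma coeff_funpow_pCons_0:
  "coeff ((pCons 0 ^^ i) p) n = (if i \<le> n then coeff p (n - i) else 0)"
  by (induction i arbitrary: n) (auto simp: coeff_pCons split: nat.split)

lemma psubst_pCons_const: "psubst (pCons 0) (\<lambda>r. [:r:]) (P :: 'a::comm_monoid_add poly) = P"
proof (rule poly_eqI)
  fix n
  have "coeff (psubst (pCons 0) (\<lambda>r. [:r:]) P) n = (\<Sum>i\<le>degree P. if i = n then coeff P i else 0)"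
    unfolding psubst_def coeff_sum coeff_funpow_pCons_0
    by (rule sum.cong) (auto simp: coeff_pCons split: nat.split)
  also have "\<dots> = coeff P n"
    by (simp add: coeff_eq_0)
  finally show "coeff (psubst (pCons 0) (\<lambda>r. [:r:]) P) n = coeff P n" .
qed

lemma coeff_0_psubst_mult_mu:
  fixes F :: "'a::zero \<Rightarrow> 'b::comm_monoid_add poly poly"
  shows "coeff (psubst mult_mu F p) 0 = coeff (F (coeff p 0)) 0"
proof -
  have pow: "coeff ((mult_mu ^^ i) Q) 0 = (if i = 0 then coeff Q 0 else 0)"
    for i and Q :: "'b poly poly"
    by (cases i) (simp_all add: mult_mu_def)
  show ?thesis
    by (simp add: psubst_def coeff_sum pow)
qed

lemma coeff_0_psubst_mult_lam:
  "coeff (psubst mult_lam F p) 0 = psubst (pCons 0) (\<lambda>x. coeff (F x) 0) p"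
  by (simp add: psubst_def coeff_sum funpow_mult_lam_coeff)

lemma coeff_0_psubst_mult_lam_mu:
  "coeff (psubst mult_lam_mu F p) 0 = psubst (pCons 0) (\<lambda>x. coeff (F x) 0) p"
  by (simp add: psubst_def coeff_sum funpow_mult_lam_mu_coeff_0)

lemma coeff_0_const2: "coeff (const2 r) 0 = [:r:]"
  by (simp add: const2_def)

text \<open>
  In \<open>R[\<lambda>, \<mu>]\<close> the outer variable is \<open>\<mu>\<close>, so taking the zeroth coefficient sets \<open>\<mu> = 0\<close>. The bracket
  at \<open>\<lambda> + \<mu>\<close> becomes the bracket at \<open>\<lambda>\<close>, and brackets at \<open>\<mu>\<close> become zeroth products.
\<close>

lemma conformal_leibniz_at_mu_0:
  assumes "conformal_leibniz R d x y"
  shows "d (coeff (lbr R x y) 0) =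
    psubst (pCons 0) (\<lambda>z. lbr R z y) (d x) + psubst (pCons 0) (\<lambda>z. [:coeff (lbr R x z) 0:]) (d y)"
  using arg_cong[OF assms[unfolded conformal_leibniz_def], of "\<lambda>P. coeff P 0"]
  by (simp add: coeff_0_psubst_mult_mu coeff_0_psubst_mult_lam coeff_0_psubst_mult_lam_mu
      coeff_0_const2 psubst_pCons_const)

section \<open>Components and substitutions\<close>

text \<open>The coefficient of \<open>x\<^sub>\<delta>\<close>, as a polynomial in \<open>\<partial>\<close> (inner variable) and \<open>\<lambda>\<close> (outer variable).\<close>

definition component :: "complex \<Rightarrow> (complex \<Rightarrow>\<^sub>0 complex poly) poly \<Rightarrow> complex poly poly" where
  "component \<delta> = map_poly (\<lambda>u. Poly_Mapping.lookup u \<delta>)"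

lemma coeff_component [simp]: "coeff (component \<delta> P) i = Poly_Mapping.lookup (coeff P i) \<delta>"
  by (simp add: component_def coeff_map_poly)

lemma component_eqI: "(\<And>\<delta>. component \<delta> P = component \<delta> Q) \<Longrightarrow> P = Q"
  by (intro poly_eqI poly_mapping_eqI) (metis coeff_component)

lemma component_0 [simp]: "component \<delta> 0 = 0"
  by (simp add: component_def)

lemma component_add: "component \<delta> (P + Q) = component \<delta> P + component \<delta> Q"
  by (rule poly_eqI) (simp add: lookup_add)

lemma component_pCons: "component \<delta> (pCons u P) = pCons (Poly_Mapping.lookup u \<delta>) (component \<delta> P)"
  by (rule poly_eqI) (simp add: coeff_pCons split: nat.split)

lemma component_sum: "component \<delta> (sum F A) = (\<Sum>x\<in>A. component \<delta> (F x))"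
  by (rule poly_eqI) (simp add: coeff_sum lookup_sum)

lemma component_map_single:
  "component \<delta> (map_poly (Poly_Mapping.single \<gamma>) Q) = (if \<gamma> = \<delta> then Q else 0)"
  by (rule poly_eqI) (simp add: coeff_map_poly lookup_single)

lemma component_map_mult: "component \<delta> (map_poly (Poly_Mapping.map ((*) p)) P) = [:p:] * component \<delta> P"
  by (rule poly_eqI) (simp add: coeff_map_poly map_mult_0 map.rep_eq when_def)

lemma component_psubst_pCons:
  "component \<delta> (psubst (pCons 0) F P) = (\<Sum>i\<le>degree P. [:0, 1:] ^ i * component \<delta> (F (coeff P i)))"
proof -
  have "component \<delta> ((pCons 0 ^^ i) Q) = [:0, 1:] ^ i * component \<delta> Q" for i Q
    by (induction i) (simp_all add: component_pCons)
  then show ?thesis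
    by (simp add: psubst_def component_sum)
qed

text \<open>
  The two substitutions of sesquilinearity: \<open>p(-\<lambda>)\<close> comes from the first argument of a bracket and
  \<open>p(\<partial> + \<lambda>)\<close> from the second, or from the argument of a conformal linear map.
\<close>

definition at_minus_lam :: "complex poly \<Rightarrow> complex poly poly" where
  "at_minus_lam p = psub2 p (- [:0, 1:])"

definition at_del_plus_lam :: "complex poly \<Rightarrow> complex poly poly" where
  "at_del_plus_lam p = psub2 p ([:[:0, 1:]:] + [:0, 1:])"

lemma ishom_at_minus_lam: "ishom at_minus_lam"
  using ev1_hom[OF ishom_const2] by (simp add: at_minus_lam_def[abs_def] psub2_ev1)

lemma ishom_at_del_plus_lam: "ishom at_del_plus_lam"
  using ev1_hom[OF ishom_const2]
  by (simp add: at_del_plus_lam_def[abs_def] psub2_ev1 del: add_pCons)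

lemma at_minus_lam_pCons: "at_minus_lam (pCons c p) = [:[:c:]:] - [:0, 1:] * at_minus_lam p"
  unfolding at_minus_lam_def psub2_ev1 ev1_pCons[OF ishom_const2] by simp

lemma at_del_plus_lam_pCons:
  "at_del_plus_lam (pCons c p) = [:[:c:]:] + ([:[:0, 1:]:] + [:0, 1:]) * at_del_plus_lam p"
  unfolding at_del_plus_lam_def psub2_ev1 ev1_pCons[OF ishom_const2] ..

lemma poly_at_minus_lam: "poly (at_minus_lam p) [:c:] = [:poly p (- c):]"
proof (induction p)
  case 0
  then show ?case by (simp add: at_minus_lam_def)
next
  case (pCons a p)
  then show ?case by (simp add: at_minus_lam_pCons)
qed

lemma coeff_0_at_del_plus_lam: "coeff (at_del_plus_lam p) 0 = p"
proof (induction p)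
  case 0
  then show ?case by (simp add: at_del_plus_lam_def)
next
  case (pCons a p)
  then show ?case by (simp add: at_del_plus_lam_pCons coeff_mult_0)
qed

text \<open>
  If \<open>Q = Q(\<partial>, \<lambda>)\<close> then \<open>poly Q [:0, - 1:]\<close> is \<open>Q(\<partial>, -\<partial>)\<close>, so the left-hand side is \<open>Q(-\<lambda>, \<lambda>)\<close>. This
  shows that \<open>Q(-\<lambda>, \<lambda>)\<close> lies in the image of the one-variable substitution, which is where
  the division by a linear factor takes place.
\<close>

lemma at_minus_lam_poly:
  "at_minus_lam (poly Q [:0, - 1:]) = (\<Sum>i\<le>degree Q. [:0, 1:] ^ i * at_minus_lam (coeff Q i))"
proof -
  note h = ishomD[OF ishom_at_minus_lam]
  have h_sum: "at_minus_lam (sum F A) = (\<Sum>i\<in>A. at_minus_lam (F i))" if "finite A"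
    for F and A :: "nat set"
    using that by (induction A) (simp_all add: h(1,3))
  have X: "at_minus_lam [:0, - 1:] = [:0, 1:]"
    by (simp add: at_minus_lam_pCons h(1))
  have h_power: "at_minus_lam (p ^ i) = at_minus_lam p ^ i" for p i
    by (induction i) (simp_all add: h(2,4))
  show ?thesis
    by (simp add: poly_altdef h_sum h(4) h_power X mult.commute)
qed

section \<open>Components of the bracket\<close>

lemma component_CL_bracket_right_single:
  "component \<delta> (CL_bracket b \<phi> u (Poly_Mapping.single \<beta> q)) =
    at_minus_lam (Poly_Mapping.lookup u (\<delta> - \<beta>)) * at_del_plus_lam q * CL_coeff b \<phi> (\<delta> - \<beta>) \<beta>"
proof (induction u rule: keys_additive_induct[where \<Delta> = UNIV])
  case 2
  show ?case by (simp add: CL_bracket_def ishomD(1)[OF ishom_at_minus_lam])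
next
  case (3 \<alpha> p)
  show ?case
    unfolding CL_bracket_single component_map_single at_minus_lam_def[symmetric] at_del_plus_lam_def[symmetric]
    by (auto simp: lookup_single when_def ishomD(1)[OF ishom_at_minus_lam] algebra_simps)
next
  case (4 u v)
  then show ?case
    by (simp add: CL_bracket_add_left component_add lookup_add ishomD(3)[OF ishom_at_minus_lam] algebra_simps)
qed simp

lemma component_CL_bracket_left_single:
  "component \<delta> (CL_bracket b \<phi> (Poly_Mapping.single \<alpha> p) v) =
    at_minus_lam p * at_del_plus_lam (Poly_Mapping.lookup v (\<delta> - \<alpha>)) * CL_coeff b \<phi> \<alpha> (\<delta> - \<alpha>)"
proof (induction v rule: keys_additive_induct[where \<Delta> = UNIV])
  case 2
  show ?case by (simp add: CL_bracket_def ishomD(1)[OF ishom_at_del_plus_lam])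
next
  case (3 \<beta> q)
  show ?case
    unfolding CL_bracket_single component_map_single at_minus_lam_def[symmetric] at_del_plus_lam_def[symmetric]
    by (auto simp: lookup_single when_def ishomD(1)[OF ishom_at_del_plus_lam] algebra_simps)
next
  case (4 u v)
  then show ?case
    by (simp add: CL_bracket_add_right component_add lookup_add ishomD(3)[OF ishom_at_del_plus_lam] algebra_simps)
qed simp

text \<open>
  The zeroth product with \<open>x\<^sub>0\<close> is diagonal: it multiplies \<open>x\<^sub>\<delta>\<close> by \<open>C\<^bsub>0,\<delta>\<^esub>(\<partial>, 0) = b\<partial> - \<phi>(\<delta>)\<close>, and the
  shift \<open>\<partial> + \<lambda>\<close> in the second argument is invisible at \<open>\<lambda> = 0\<close>.
\<close>

lemma coeff_0_CL_bracket_x0: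
  assumes "b \<noteq> 0" "\<phi> 0 = 0"
  shows "Poly_Mapping.lookup (coeff (CL_bracket b \<phi> (Poly_Mapping.single 0 1) v) 0) \<delta> =
    [:- \<phi> \<delta>, b:] * Poly_Mapping.lookup v \<delta>"
proof -
  have "Poly_Mapping.lookup (coeff (CL_bracket b \<phi> (Poly_Mapping.single 0 1) v) 0) \<delta> =
      coeff (component \<delta> (CL_bracket b \<phi> (Poly_Mapping.single 0 1) v)) 0"
    by simp
  also have "\<dots> = Poly_Mapping.lookup v \<delta> * coeff (CL_coeff b \<phi> 0 \<delta>) 0"
    by (simp only: component_CL_bracket_left_single ishomD(2)[OF ishom_at_minus_lam] coeff_mult_0
        coeff_0_at_del_plus_lam diff_0_right mult_1_left)
  also have "coeff (CL_coeff b \<phi> 0 \<delta>) 0 = [:- \<phi> \<delta>, b:]"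
    using assms by (simp add: CL_coeff_def)
  finally show ?thesis
    by (simp add: mult.commute)
qed

section \<open>Conformal linear maps\<close>

text \<open>
  Iterating \<open>d\<^sub>\<lambda>(\<partial>u) = (\<partial> + \<lambda>) d\<^sub>\<lambda> u\<close> determines \<open>d\<close> on \<open>\<complex>[\<partial>] x\<^sub>\<beta>\<close> from its value at \<open>x\<^sub>\<beta>\<close>.
\<close>

lemma component_conformal_linear_single:
  assumes d: "conformal_linear (CL \<Delta> b \<phi>) d" and \<beta>: "\<beta> \<in> \<Delta>"
  shows "component \<delta> (d (Poly_Mapping.single \<beta> p)) =
    at_del_plus_lam p * component \<delta> (d (Poly_Mapping.single \<beta> 1))"
proof -
  let ?x = "Poly_Mapping.single \<beta>"
  have in_carr: "Poly_Mapping.keys (?x q) \<subseteq> \<Delta>" for q :: "complex poly"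
    using \<beta> by simp
  have add: "d (?x q + ?x r) = d (?x q) + d (?x r)" for q r
    using d in_carr unfolding conformal_linear_def CL_simps by blast
  have scale: "d (Poly_Mapping.map ((*) [:c:]) (?x q)) = map_poly (Poly_Mapping.map ((*) [:c:])) (d (?x q))" for c q
    using d in_carr unfolding conformal_linear_def CL_simps cact_def by blast
  have del: "d (Poly_Mapping.map ((*) [:0, 1:]) (?x q)) =
      map_poly (Poly_Mapping.map ((*) [:0, 1:])) (d (?x q)) + pCons 0 (d (?x q))" for q
    using d in_carr unfolding conformal_linear_def CL_simps dact_def by blast
  show ?thesis
  proof (induction p)
    case 0
    have "d (?x 0) = 0"
      using add[of 0 0] by simp
    then show ?case by (simp add: ishomD(1)[OF ishom_at_del_plus_lam])
  next
    case (pCons c p)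
    have "?x (pCons c p) = Poly_Mapping.map ((*) [:c:]) (?x 1) + Poly_Mapping.map ((*) [:0, 1:]) (?x p)"
      by (simp add: map_mult_single flip: single_add)
    then have "d (?x (pCons c p)) = map_poly (Poly_Mapping.map ((*) [:c:])) (d (?x 1)) +
        (map_poly (Poly_Mapping.map ((*) [:0, 1:])) (d (?x p)) + pCons 0 (d (?x p)))"
      by (simp only: scale[symmetric] del[symmetric] map_mult_single add[symmetric])
    then have "component \<delta> (d (?x (pCons c p))) = [:[:c:]:] * component \<delta> (d (?x 1)) +
        ([:[:0, 1:]:] * component \<delta> (d (?x p)) + [:0, 1:] * component \<delta> (d (?x p)))"
      by (simp only: component_add component_map_mult component_pCons) simp
    then show ?case
      unfolding pCons.IH at_del_plus_lam_pCons by (simp only: algebra_simps)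
  qed
qed

lemma conformal_linear_eqI:
  assumes d: "conformal_linear (CL \<Delta> b \<phi>) d" and e: "conformal_linear (CL \<Delta> b \<phi>) e"
    and gen: "\<And>\<beta>. \<beta> \<in> \<Delta> \<Longrightarrow> d (Poly_Mapping.single \<beta> 1) = e (Poly_Mapping.single \<beta> 1)"
    and u: "Poly_Mapping.keys u \<subseteq> \<Delta>"
  shows "d u = e u"
proof -
  have add: "f (v + w) = f v + f w"
    if "conformal_linear (CL \<Delta> b \<phi>) f" "Poly_Mapping.keys v \<subseteq> \<Delta>" "Poly_Mapping.keys w \<subseteq> \<Delta>" for f v w
    using that unfolding conformal_linear_def CL_simps by blast
  have single: "d (Poly_Mapping.single \<beta> p) = e (Poly_Mapping.single \<beta> p)" if "\<beta> \<in> \<Delta>" for \<beta> p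
    by (rule component_eqI)
      (simp only: component_conformal_linear_single[OF d that, of _ p] component_conformal_linear_single[OF e that, of _ p] gen[OF that])
  have "Poly_Mapping.keys u \<subseteq> \<Delta> \<and> d u = e u"
    using u
  proof (rule keys_additive_induct)
    show "Poly_Mapping.keys (0 :: complex \<Rightarrow>\<^sub>0 complex poly) \<subseteq> \<Delta> \<and> d 0 = e 0"
      using add[OF d, of 0 0] add[OF e, of 0 0] by simp
  next
    fix v w assume "Poly_Mapping.keys v \<subseteq> \<Delta> \<and> d v = e v" "Poly_Mapping.keys w \<subseteq> \<Delta> \<and> d w = e w"
    then show "Poly_Mapping.keys (v + w) \<subseteq> \<Delta> \<and> d (v + w) = e (v + w)"
      using keys_add[of v w] by (auto simp: add[OF d] add[OF e])
  qed (auto simp: single split: if_splits)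
  then show ?thesis ..
qed

section \<open>Every conformal derivation is inner\<close>

text \<open>
  The Leibniz rule for \<open>x\<^sub>0\<close> and \<open>x\<^sub>\<beta>\<close> at \<open>\<mu> = 0\<close>. Both \<open>d\<^sub>\<lambda>[x\<^sub>0 \<^sub>\<mu> x\<^sub>\<beta>]\<close> and \<open>[x\<^sub>0 \<^sub>\<mu> d\<^sub>\<lambda> x\<^sub>\<beta>]\<close> are multiples of
  \<open>d\<^sub>\<lambda> x\<^sub>\<beta>\<close> in each component, and the difference of the two factors,
  \<open>b(\<partial> + \<lambda>) - \<phi>(\<beta>)\<close> and \<open>b\<partial> - \<phi>(\<gamma> + \<beta>)\<close>, is \<open>b\<lambda> + \<phi>(\<gamma>)\<close>, written below as the value at \<open>-\<lambda>\<close> of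
  \<open>\<phi>(\<gamma>) - b\<partial>\<close>.
\<close>

lemma derivation_component_equation:
  assumes "conformal_linear (CL \<Delta> b \<phi>) d"
    and leib: "conformal_leibniz (CL \<Delta> b \<phi>) d (Poly_Mapping.single 0 1) (Poly_Mapping.single \<beta> 1)"
    and "b \<noteq> 0" "\<phi> 0 = 0" "\<beta> \<in> \<Delta>" and \<phi>: "\<phi> (\<gamma> + \<beta>) = \<phi> \<gamma> + \<phi> \<beta>"
  shows "at_minus_lam [:\<phi> \<gamma>, - b:] * component (\<gamma> + \<beta>) (d (Poly_Mapping.single \<beta> 1)) =
    at_minus_lam (poly (component \<gamma> (d (Poly_Mapping.single 0 1))) [:0, - 1:]) * CL_coeff b \<phi> \<gamma> \<beta>"
proof -
  let ?L = "Poly_Mapping.single 0 1 :: complex \<Rightarrow>\<^sub>0 complex poly"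
  let ?x = "Poly_Mapping.single \<beta> 1 :: complex \<Rightarrow>\<^sub>0 complex poly"
  let ?\<delta> = "\<gamma> + \<beta>"
  define f where "f = component ?\<delta> (d ?x)"
  define f0 where "f0 = component \<gamma> (d ?L)"
  have "coeff (CL_bracket b \<phi> ?L ?x) 0 = Poly_Mapping.single \<beta> [:- \<phi> \<beta>, b:]"
    by (rule poly_mapping_eqI)
      (simp only: coeff_0_CL_bracket_x0[where \<phi> = \<phi>, OF assms(3,4)], simp add: lookup_single when_def)
  then have eq: "d (Poly_Mapping.single \<beta> [:- \<phi> \<beta>, b:]) =
      psubst (pCons 0) (\<lambda>z. CL_bracket b \<phi> z ?x) (d ?L) +
      psubst (pCons 0) (\<lambda>z. [:coeff (CL_bracket b \<phi> ?L z) 0:]) (d ?x)"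
    using conformal_leibniz_at_mu_0[OF leib] by (simp only: CL_simps)
  have lhs: "component ?\<delta> (d (Poly_Mapping.single \<beta> [:- \<phi> \<beta>, b:])) = at_del_plus_lam [:- \<phi> \<beta>, b:] * f"
    unfolding f_def by (rule component_conformal_linear_single[OF assms(1,5)])
  have rhs1: "component ?\<delta> (psubst (pCons 0) (\<lambda>z. CL_bracket b \<phi> z ?x) (d ?L)) =
      at_minus_lam (poly f0 [:0, - 1:]) * CL_coeff b \<phi> \<gamma> \<beta>"
  proof -
    (* The degree in \<lambda> may drop when passing to one component. *)
    have "(\<Sum>i\<le>degree (d ?L). [:0, 1:] ^ i * at_minus_lam (coeff f0 i)) =
        (\<Sum>i\<le>degree f0. [:0, 1:] ^ i * at_minus_lam (coeff f0 i))"
      by (rule sum.mono_neutral_right)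
        (auto simp: f0_def[unfolded component_def] map_poly_degree_leq coeff_eq_0 ishomD(1)[OF ishom_at_minus_lam] simp del: coeff_component single_one)
    then show ?thesis
      by (simp add: component_psubst_pCons component_CL_bracket_right_single ishomD(2)[OF ishom_at_del_plus_lam]
          at_minus_lam_poly f0_def mult.assoc[symmetric] sum_distrib_right[symmetric] del: single_one)
  qed
  have rhs2: "component ?\<delta> (psubst (pCons 0) (\<lambda>z. [:coeff (CL_bracket b \<phi> ?L z) 0:]) (d ?x)) =
      [:[:- \<phi> ?\<delta>, b:]:] * f"
  proof -
    have const: "[:k * c:] = [:k:] * [:c:]" for k c :: "complex poly"
      by simp
    have "component ?\<delta> (psubst (pCons 0) (\<lambda>z. [:coeff (CL_bracket b \<phi> ?L z) 0:]) (d ?x)) =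
        [:[:- \<phi> ?\<delta>, b:]:] * component ?\<delta> (psubst (pCons 0) (\<lambda>r. [:r:]) (d ?x))"
      by (simp only: component_psubst_pCons component_pCons component_0 coeff_0_CL_bracket_x0[where \<phi> = \<phi>, OF assms(3,4)]
          const sum_distrib_left mult.left_commute)
    then show ?thesis
      by (simp only: psubst_pCons_const f_def)
  qed
  have "at_del_plus_lam [:- \<phi> \<beta>, b:] = at_minus_lam [:\<phi> \<gamma>, - b:] + [:[:- \<phi> ?\<delta>, b:]:]"
    by (simp add: at_del_plus_lam_pCons at_minus_lam_pCons \<phi>
        ishomD(1)[OF ishom_at_del_plus_lam] ishomD(1)[OF ishom_at_minus_lam])
  then show ?thesis
    using arg_cong[OF eq, of "component ?\<delta>"]
    by (simp only: component_add lhs rhs1 rhs2 distrib_right f_def[symmetric] f0_def[symmetric] add_right_cancel)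
qed

text \<open>
  Evaluating the equation at the root \<open>\<lambda> = -\<phi>(\<gamma>)/b\<close> of \<open>b\<lambda> + \<phi>(\<gamma>)\<close> kills the left-hand side. There
  \<open>C\<^bsub>\<gamma>,\<beta>\<^esub>\<close> is a polynomial in \<open>\<partial>\<close> with leading coefficient \<open>\<gamma> + b \<noteq> 0\<close>, so the other factor has this root
  and is divisible by \<open>b\<lambda> + \<phi>(\<gamma>)\<close>.
\<close>

lemma derivation_component_inner:
  assumes eq: "at_minus_lam [:\<phi> \<gamma>, - b:] * f = at_minus_lam p * CL_coeff b \<phi> \<gamma> \<beta>"
    and "b \<noteq> 0" "\<gamma> + b \<noteq> 0"
  shows "f = at_minus_lam (p div [:\<phi> \<gamma>, - b:]) * CL_coeff b \<phi> \<gamma> \<beta>"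
proof -
  let ?q = "[:\<phi> \<gamma>, - b:]"
  have "poly (at_minus_lam ?q) [:- (\<phi> \<gamma> / b):] = 0"
    using \<open>b \<noteq> 0\<close> by (simp add: poly_at_minus_lam)
  then have "poly (at_minus_lam p) [:- (\<phi> \<gamma> / b):] * poly (CL_coeff b \<phi> \<gamma> \<beta>) [:- (\<phi> \<gamma> / b):] = 0"
    using arg_cong[OF eq, of "\<lambda>P. poly P [:- (\<phi> \<gamma> / b):]"] by simp
  moreover have "poly (CL_coeff b \<phi> \<gamma> \<beta>) [:- (\<phi> \<gamma> / b):] \<noteq> 0"
    using \<open>\<gamma> + b \<noteq> 0\<close> by (simp add: CL_coeff_def)
  ultimately have "poly p (\<phi> \<gamma> / b) = 0"
    by (simp add: poly_at_minus_lam)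
  then have "[:- (\<phi> \<gamma> / b), 1:] dvd p"
    by (simp add: poly_eq_0_iff_dvd)
  moreover have "?q = smult (- b) [:- (\<phi> \<gamma> / b), 1:]"
    using \<open>b \<noteq> 0\<close> by simp
  ultimately have "?q dvd p"
    using \<open>b \<noteq> 0\<close> by (simp only: smult_dvd_iff) simp
  then have "at_minus_lam p = at_minus_lam ?q * at_minus_lam (p div ?q)"
    by (simp only: ishomD(4)[OF ishom_at_minus_lam, symmetric] dvd_mult_div_cancel)
  moreover have "at_minus_lam ?q \<noteq> 0"
  proof
    assume "at_minus_lam ?q = 0"
    (* At this value of the variable the linear factor equals 1. *)
    then have "poly (at_minus_lam ?q) [:(1 - \<phi> \<gamma>) / b:] = 0"
      by simp
    then show False
      using \<open>b \<noteq> 0\<close> by (simp add: poly_at_minus_lam)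
  qed
  ultimately show ?thesis
    using eq by (simp only: mult.assoc mult_cancel_left) simp
qed

theorem theorem4p4:
  fixes \<Delta> :: "complex set" and b :: complex and \<phi> :: "complex \<Rightarrow> complex"
  assumes "infinite \<Delta>"
    and "0 \<in> \<Delta>"
    and "\<And>\<alpha> \<beta>. \<alpha> \<in> \<Delta> \<Longrightarrow> \<beta> \<in> \<Delta> \<Longrightarrow> \<alpha> + \<beta> \<in> \<Delta>"
    and "\<And>\<alpha>. \<alpha> \<in> \<Delta> \<Longrightarrow> - \<alpha> \<in> \<Delta>"
    and "2 * b \<notin> \<Delta>"
    and "\<And>\<alpha> \<beta>. \<alpha> \<in> \<Delta> \<Longrightarrow> \<beta> \<in> \<Delta> \<Longrightarrow> \<phi> (\<alpha> + \<beta>) = \<phi> \<alpha> + \<phi> \<beta>"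
  shows "CDer (CL \<Delta> b \<phi>) = CInn (CL \<Delta> b \<phi>)"
proof
  have lie: "lie_conformal_algebra (CL \<Delta> b \<phi>)"
    using assms(2,3,5,6) by (rule lie_conformal_algebra_CL)
  then show CInn_sub: "CInn (CL \<Delta> b \<phi>) \<subseteq> CDer (CL \<Delta> b \<phi>)"
    by (rule CInn_subset_CDer)
  have b0: "b \<noteq> 0"
    using assms(2,5) by auto
  have \<phi>0: "\<phi> 0 = 0"
    using assms(6)[OF assms(2,2)] by simp
  have b_notin: "b \<notin> \<Delta>"
    using assms(3)[of b b] assms(5) by (metis mult_2)
  have \<gamma>b: "\<gamma> + b \<noteq> 0" if "\<gamma> \<in> \<Delta>" for \<gamma>
    using assms(4)[OF that] b_notin by (metis minus_unique)
  show "CDer (CL \<Delta> b \<phi>) \<subseteq> CInn (CL \<Delta> b \<phi>)"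
  proof
    fix d assume d: "d \<in> CDer (CL \<Delta> b \<phi>)"
    then have leib: "conformal_leibniz (CL \<Delta> b \<phi>) d (Poly_Mapping.single 0 1) (Poly_Mapping.single \<beta> 1)"
        if "\<beta> \<in> \<Delta>" for \<beta>
      using assms(2) that by (auto simp: CDer_def)
    have lin: "conformal_linear (CL \<Delta> b \<phi>) d"
      using d by (simp add: CDer_def)
    let ?x = "\<lambda>\<beta>. Poly_Mapping.single \<beta> 1 :: complex \<Rightarrow>\<^sub>0 complex poly"
    have keys_d: "Poly_Mapping.keys (coeff (d (?x \<beta>)) i) \<subseteq> \<Delta>" if "\<beta> \<in> \<Delta>" for \<beta> i
      using lin that by (simp add: conformal_linear_def)
    have component_outside: "component \<delta> (d (?x \<beta>)) = 0" if "\<beta> \<in> \<Delta>" "\<delta> \<notin> \<Delta>" for \<beta> \<delta>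
    proof (rule poly_eqI)
      fix i
      have "\<delta> \<notin> Poly_Mapping.keys (coeff (d (?x \<beta>)) i)"
        using keys_d[OF that(1)] that(2) by blast
      then show "coeff (component \<delta> (d (?x \<beta>))) i = coeff 0 i"
        by (simp add: in_keys_iff del: single_one)
    qed
    (* Defined for every index: where d x_0 has no component the quotient is zero, so g has finite
       support and vanishes outside \<Delta>. *)
    define g where "g \<gamma> = poly (component \<gamma> (d (?x 0))) [:0, - 1:] div [:\<phi> \<gamma>, - b:]" for \<gamma>
    have "{\<gamma>. g \<gamma> \<noteq> 0} \<subseteq> (\<Union>i\<le>degree (d (?x 0)). Poly_Mapping.keys (coeff (d (?x 0)) i))"
    proof
      fix \<gamma> assume "\<gamma> \<in> {\<gamma>. g \<gamma> \<noteq> 0}"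
      then have "component \<gamma> (d (?x 0)) \<noteq> 0"
        by (auto simp: g_def)
      then obtain i where i: "coeff (component \<gamma> (d (?x 0))) i \<noteq> 0"
        by (metis poly_eqI coeff_0)
      then have "i \<le> degree (d (?x 0))"
        by (intro le_degree) auto
      with i show "\<gamma> \<in> (\<Union>i\<le>degree (d (?x 0)). Poly_Mapping.keys (coeff (d (?x 0)) i))"
        by (auto simp: in_keys_iff)
    qed
    then have "finite {\<gamma>. g \<gamma> \<noteq> 0}"
      by (rule finite_subset) simp
    define a where "a = Abs_poly_mapping g"
    have lookup_a: "Poly_Mapping.lookup a = g"
      using \<open>finite _\<close> by (simp add: a_def)
    have g_outside: "g \<gamma> = 0" if "\<gamma> \<notin> \<Delta>" for \<gamma>
      using component_outside[OF assms(2) that] by (simp add: g_def)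
    then have a: "a \<in> carr (CL \<Delta> b \<phi>)"
      unfolding CL_simps mem_Collect_eq by (metis in_keys_iff lookup_a subsetI)
    have component_d: "component \<delta> (d (?x \<beta>)) = at_minus_lam (g (\<delta> - \<beta>)) * CL_coeff b \<phi> (\<delta> - \<beta>) \<beta>"
      if \<beta>: "\<beta> \<in> \<Delta>" for \<beta> \<delta>
    proof (cases "\<delta> - \<beta> \<in> \<Delta>")
      case True
      have "\<phi> (\<delta> - \<beta> + \<beta>) = \<phi> (\<delta> - \<beta>) + \<phi> \<beta>"
        using True \<beta> by (rule assms(6))
      from derivation_component_inner[OF derivation_component_equation[OF lin leib[OF \<beta>] b0 \<phi>0 \<beta> this] b0 \<gamma>b[OF True]]
      show ?thesis
        by (simp add: g_def)
    next
      case False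
      then have "\<delta> \<notin> \<Delta>"
        using assms(3)[of \<delta> "- \<beta>"] assms(4)[OF \<beta>] by auto
      then show ?thesis
        by (simp add: g_outside[OF False] component_outside[OF \<beta>] ishomD(1)[OF ishom_at_minus_lam])
    qed
    have cad: "cad (CL \<Delta> b \<phi>) a \<in> CDer (CL \<Delta> b \<phi>)"
      using CInn_sub a by (auto simp: CInn_def)
    have cad_lin: "conformal_linear (CL \<Delta> b \<phi>) (cad (CL \<Delta> b \<phi>) a)"
      using cad by (simp add: CDer_def)
    have gen: "d (?x \<beta>) = cad (CL \<Delta> b \<phi>) a (?x \<beta>)" if "\<beta> \<in> \<Delta>" for \<beta>
      using that
      by (intro component_eqI)
        (simp add: cad_def component_CL_bracket_right_single component_d lookup_a ishomD(2)[OF ishom_at_del_plus_lam])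
    have eq: "d u = cad (CL \<Delta> b \<phi>) a u" if "u \<in> carr (CL \<Delta> b \<phi>)" for u
      using conformal_linear_eqI[OF lin cad_lin gen] that by (simp only: CL_simps mem_Collect_eq)
    have ext: "d \<in> extensional (carr (CL \<Delta> b \<phi>))"
      "cad (CL \<Delta> b \<phi>) a \<in> extensional (carr (CL \<Delta> b \<phi>))"
      using d cad unfolding CDer_def by blast+
    have "d = cad (CL \<Delta> b \<phi>) a"
      using ext eq by (rule extensionalityI)
    with a show "d \<in> CInn (CL \<Delta> b \<phi>)"
      by (simp add: CInn_def)
  qed
qed

end
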